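(* For any memory cell $\mathcal{S}_{\mathcal{X}}=\{\mathcal{N}^x_{A\to B}\}_{x\in\mathcal{X}}$, $$\mathcal{C}(\mathcal{S}_{\mathcal{X}})\le\sup_{\rho_{XRA}}\big[I(X;B|R)_\omega-I(X;A|R)_\rho\big],$$ where the supremum is over classical–quantum states $\rho_{XRA}=\sum_{x}p_X(x)|x\rangle\langle x|_X\otimes\rho^x_{RA}$ (with $p_X$ a distribution on $\mathcal{X}$, $\rho^x_{RA}$ states, and $\mathcal{H}_R$ of arbitrary finite dimension), and $\omega_{XRB}=\sum_xp_X(x)|x\rangle\langle x|_X\otimes\mathcal{N}^x_{A\to B}(\rho^x_{RA})$.
   Context: Finite $\mathcal{X}$, finite-dimensional $A,B$. An $(n,R,\varepsilon)$ quantum reading protocol: message set $\mathcal{M}$, $R=\frac1n\log_2|\mathcal{M}|$, encoding $m\mapsto x^n(m)\in\mathcal{X}^n$, adaptive strategy (initial state $\rho_{R_1A_1}$, interleaved channels $\mathcal{A}^i_{R_iB_i\to R_{i+1}A_{i+1}}$ for $i=1,\dots,n-1$, final POVM $\{\Lambda^{\hat m}_{R_nB_n}\}$, where the $i$-th call applies $\mathcal{N}^{x_i(m)}$ to $A_i$), with $\frac1{|\mathcal{M}|}\sum_m\mathrm{Tr}\{\Lambda^m(\mathcal{N}^{x_n(m)}\circ\mathcal{A}^{n-1}\circ\cdots\circ\mathcal{A}^1\circ\mathcal{N}^{x_1(m)})(\rho_{R_1A_1})\}\ge1-\varepsilon$. $R$ is achievable if for all $\varepsilon\in(0,1)$, $\delta>0$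 and large $n$ an $(n,R-\delta,\varepsilon)$ protocol exists; the quantum reading capacity $\mathcal{C}$ is the supremum of achievable rates. $I(X;B|R)$ is conditional quantum mutual information. *)

theory Defs
  imports Complex_Main "HOL-Library.Extended_Real" "Jordan_Normal_Form.Matrix" "Jordan_Normal_Form.Char_Poly"
begin

text \<open>A system of dimension d is represented by d x d complex matrices.
  A composite system with dimensions d1, d2 uses the basis index i1 * d2 + i2.\<close>

definition psd :: "nat \<Rightarrow> complex mat \<Rightarrow> bool" where
  "psd d M \<longleftrightarrow> M \<in> carrier_mat d d \<and>
     (\<forall>v :: nat \<Rightarrow> complex.
        let q = (\<Sum>i<d. \<Sum>j<d. cnj (v i) * M $$ (i, j) * v j) in Im q = 0 \<and> Re q \<ge> 0)"

definition mtrace :: "nat \<Rightarrow> complex mat \<Rightarrow> complex" where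
  "mtrace d M = (\<Sum>i<d. M $$ (i, i))"

definition density :: "nat \<Rightarrow> complex mat \<Rightarrow> bool" where
  "density d \<rho> \<longleftrightarrow> psd d \<rho> \<and> mtrace d \<rho> = 1"

definition blk :: "nat \<Rightarrow> complex mat \<Rightarrow> nat \<Rightarrow> nat \<Rightarrow> complex mat" where
  "blk d X r s = mat d d (\<lambda>(a, b). X $$ (r * d + a, s * d + b))"

definition id_tensor :: "nat \<Rightarrow> nat \<Rightarrow> nat \<Rightarrow> (complex mat \<Rightarrow> complex mat) \<Rightarrow> complex mat \<Rightarrow> complex mat" where
  "id_tensor k din dout \<Phi> X =
     mat (k * dout) (k * dout)
       (\<lambda>(i, j). \<Phi> (blk din X (i div dout) (j div dout)) $$ (i mod dout, j mod dout))"

definition channel :: "nat \<Rightarrow> nat \<Rightarrow> (complex mat \<Rightarrow> complex mat) \<Rightarrow> bool" where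
  "channel din dout \<Phi> \<longleftrightarrow>
     (\<forall>X \<in> carrier_mat din din. \<Phi> X \<in> carrier_mat dout dout) \<and>
     (\<forall>X \<in> carrier_mat din din. \<forall>Y \<in> carrier_mat din din. \<forall>c :: complex.
         \<Phi> (c \<cdot>\<^sub>m X + Y) = c \<cdot>\<^sub>m \<Phi> X + \<Phi> Y) \<and>
     (\<forall>X \<in> carrier_mat din din. mtrace dout (\<Phi> X) = mtrace din X) \<and>
     (\<forall>k X. psd (k * din) X \<longrightarrow> psd (k * dout) (id_tensor k din dout \<Phi> X))"

definition eigvals :: "nat \<Rightarrow> complex mat \<Rightarrow> complex list" where
  "eigvals d M = (SOME as. length as = d \<and> char_poly M = (\<Prod>a\<leftarrow>as. [:- a, 1:]))"

definition eta :: "real \<Rightarrow> real" where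
  "eta t = (if t \<le> 0 then 0 else - t * log 2 t)"

definition vN_entropy :: "nat \<Rightarrow> complex mat \<Rightarrow> real" where
  "vN_entropy d \<rho> = (\<Sum>a\<leftarrow>eigvals d \<rho>. eta (Re a))"

definition ptrace2 :: "nat \<Rightarrow> nat \<Rightarrow> complex mat \<Rightarrow> complex mat" where
  "ptrace2 d1 d2 M = mat d1 d1 (\<lambda>(i, j). \<Sum>b<d2. M $$ (i * d2 + b, j * d2 + b))"

definition ptrace1 :: "nat \<Rightarrow> nat \<Rightarrow> complex mat \<Rightarrow> complex mat" where
  "ptrace1 d1 d2 M = mat d2 d2 (\<lambda>(i, j). \<Sum>a<d1. M $$ (a * d2 + i, a * d2 + j))"

definition cmi :: "nat \<Rightarrow> nat \<Rightarrow> nat \<Rightarrow> complex mat \<Rightarrow> real" where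
  "cmi dX dR dB M =
     vN_entropy (dX * dR) (ptrace2 (dX * dR) dB M)
   + vN_entropy (dR * dB) (ptrace1 dX (dR * dB) M)
   - vN_entropy dR (ptrace2 dR dB (ptrace1 dX (dR * dB) M))
   - vN_entropy (dX * (dR * dB)) M"

definition cq_state :: "nat \<Rightarrow> nat \<Rightarrow> (nat \<Rightarrow> real) \<Rightarrow> (nat \<Rightarrow> complex mat) \<Rightarrow> complex mat" where
  "cq_state nX d p \<sigma> =
     mat (nX * d) (nX * d)
       (\<lambda>(i, j). if i div d = j div d
                 then complex_of_real (p (i div d)) * \<sigma> (i div d) $$ (i mod d, j mod d) else 0)"

definition memory_cell :: "nat \<Rightarrow> nat \<Rightarrow> nat \<Rightarrow> (nat \<Rightarrow> complex mat \<Rightarrow> complex mat) \<Rightarrow> bool" where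
  "memory_cell nX dA dB N \<longleftrightarrow> 0 < nX \<and> 0 < dA \<and> 0 < dB \<and> (\<forall>x<nX. channel dA dB (N x))"

text \<open>The state on R_i \<otimes> B_i after the (i+1)-th call (rounds indexed from 0) for message m.
  dR i is the dimension of R_i, \<rho> the initial state on R_0 \<otimes> A_0,
  Ach i the interleaved channel R_i B_i \<rightarrow> R_{i+1} A_{i+1}, enc m i the i-th letter of x^n(m).\<close>
fun reading_out :: "(nat \<Rightarrow> complex mat \<Rightarrow> complex mat) \<Rightarrow> nat \<Rightarrow> nat \<Rightarrow> (nat \<Rightarrow> nat)
    \<Rightarrow> complex mat \<Rightarrow> (nat \<Rightarrow> complex mat \<Rightarrow> complex mat) \<Rightarrow> (nat \<Rightarrow> nat \<Rightarrow> nat) \<Rightarrow> nat \<Rightarrow> nat \<Rightarrow> complex mat" where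
  "reading_out N dA dB dR \<rho> Ach enc m 0 = id_tensor (dR 0) dA dB (N (enc m 0)) \<rho>"
| "reading_out N dA dB dR \<rho> Ach enc m (Suc i) =
     id_tensor (dR (Suc i)) dA dB (N (enc m (Suc i))) (Ach i (reading_out N dA dB dR \<rho> Ach enc m i))"

definition reading_protocol :: "nat \<Rightarrow> nat \<Rightarrow> nat \<Rightarrow> (nat \<Rightarrow> complex mat \<Rightarrow> complex mat)
    \<Rightarrow> nat \<Rightarrow> real \<Rightarrow> real \<Rightarrow> bool" where
  "reading_protocol nX dA dB N n R \<epsilon> \<longleftrightarrow>
     (\<exists>(M :: nat) (enc :: nat \<Rightarrow> nat \<Rightarrow> nat) (dR :: nat \<Rightarrow> nat) (\<rho> :: complex mat)
        (Ach :: nat \<Rightarrow> complex mat \<Rightarrow> complex mat) (\<Lambda> :: nat \<Rightarrow> complex mat).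
        0 < M \<and> log 2 (real M) / real n \<ge> R \<and>
        (\<forall>m<M. \<forall>i<n. enc m i < nX) \<and>
        (\<forall>i<n. 0 < dR i) \<and>
        density (dR 0 * dA) \<rho> \<and>
        (\<forall>i. Suc i < n \<longrightarrow> channel (dR i * dB) (dR (Suc i) * dA) (Ach i)) \<and>
        (\<forall>m<M. psd (dR (n - 1) * dB) (\<Lambda> m)) \<and>
        (\<forall>i<dR (n - 1) * dB. \<forall>j<dR (n - 1) * dB.
            (\<Sum>m<M. \<Lambda> m $$ (i, j)) = (if i = j then 1 else 0)) \<and>
        (1 / real M) * (\<Sum>m<M. Re (mtrace (dR (n - 1) * dB) (\<Lambda> m * reading_out N dA dB dR \<rho> Ach enc m (n - 1))))
          \<ge> 1 - \<epsilon>)"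

definition achievable_rate :: "nat \<Rightarrow> nat \<Rightarrow> nat \<Rightarrow> (nat \<Rightarrow> complex mat \<Rightarrow> complex mat) \<Rightarrow> real \<Rightarrow> bool" where
  "achievable_rate nX dA dB N R \<longleftrightarrow>
     (\<forall>\<epsilon>. 0 < \<epsilon> \<and> \<epsilon> < 1 \<longrightarrow> (\<forall>\<delta>>0. \<forall>\<^sub>F n in sequentially.
        0 < n \<and> reading_protocol nX dA dB N n (R - \<delta>) \<epsilon>))"

definition reading_capacity :: "nat \<Rightarrow> nat \<Rightarrow> nat \<Rightarrow> (nat \<Rightarrow> complex mat \<Rightarrow> complex mat) \<Rightarrow> ereal" where
  "reading_capacity nX dA dB N = Sup {ereal R | R. achievable_rate nX dA dB N R}"

definition reading_bound :: "nat \<Rightarrow> nat \<Rightarrow> nat \<Rightarrow> (nat \<Rightarrow> complex mat \<Rightarrow> complex mat) \<Rightarrow> ereal" where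
  "reading_bound nX dA dB N =
     Sup {ereal (cmi nX dR dB (cq_state nX (dR * dB) p (\<lambda>x. id_tensor dR dA dB (N x) (\<sigma> x)))
                 - cmi nX dR dA (cq_state nX (dR * dA) p \<sigma>))
          | dR p \<sigma>. 0 < dR \<and> (\<forall>x<nX. 0 \<le> p x) \<and> (\<Sum>x<nX. p x) = 1 \<and>
                    (\<forall>x<nX. density (dR * dA) (\<sigma> x))}"

end

theory Submission
  imports Defs "Jordan_Normal_Form.Schur_Decomposition" "Jordan_Normal_Form.Spectral_Radius"
begin

text \<open>The information between the message and the systems held by the reader starts at zero,
  cannot grow under the interleaved channels (data processing), and grows during the i-th call
  by at most I(X;B|R) - I(X;A|R), because for a given letter X the call is a fixed channel.
  Fano's inequality bounds the number of messages by the final information.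

  The deep ingredient is monotonicity of the relative entropy. Up to normalisation it is the
  integral over t > 0 of the maximum over X of
  2 Re Tr(X^* \<rho>) - Tr(\<sigma> X X^*) - t Tr(\<rho> X^* X), and the Schwarz inequality for the adjoint of a
  channel shows that every value of this functional at the output is dominated by one at the
  input.\<close>

section \<open>Spectral theorem and entropy\<close>

text \<open>Matrix logarithms never occur. With eigenvectors u_i of \<rho> and v_j of \<sigma>, the
  relative entropy is the classical one of the weights p_i |<v_j, u_i>|^2 and q_j |<v_j, u_i>|^2,
  and the trace functional splits into one quadratic per pair (i, j), so its maximum and the
  integral over t are scalar calculus. The obstacle is rank-deficient states, which a protocol may
  well use. It is met by a domination condition that every member of a finite uniform mixture
  satisfies relative to the mixture. The Schwarz inequality comes straight from the definition of
  complete positivity, with a two-dimensional ancilla and one block matrix. The message is uniform,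
  so its information is the average relative entropy of the states to their mean. The link with
  I(X;B|R) - I(X;A|R) rests on the call leaving R alone: the entropies of R, XR and X cancel between
  the two terms. Fano's inequality takes the form of a test between the state of one message and the
  mean; its loss is at most one nat, 1 / ln 2 bits, and disappears after division by n.\<close>

definition dagger :: "complex mat \<Rightarrow> complex mat" where
  "dagger A = mat (dim_col A) (dim_row A) (\<lambda>(i, j). cnj (A $$ (j, i)))"

definition diagm :: "nat \<Rightarrow> (nat \<Rightarrow> real) \<Rightarrow> complex mat" where
  "diagm d f = mat d d (\<lambda>(i, j). if i = j then complex_of_real (f i) else 0)"

lemma dagger_carrier [simp, intro]: "A \<in> carrier_mat n m \<Longrightarrow> dagger A \<in> carrier_mat m n"
  by (auto simp: dagger_def)

lemma index_dagger [simp]: "i < dim_col A \<Longrightarrow> j < dim_row A \<Longrightarrow> dagger A $$ (i, j) = cnj (A $$ (j, i))"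
  by (simp add: dagger_def)

lemma dim_dagger [simp]: "dim_row (dagger A) = dim_col A" "dim_col (dagger A) = dim_row A"
  by (auto simp: dagger_def)

lemma dagger_dagger [simp]: "dagger (dagger A) = A"
  by (rule eq_matI) auto

declare index_mult_mat(1) [simp del]

lemma square_mult_carrier [simp, intro]:
  "A \<in> carrier_mat d d \<Longrightarrow> B \<in> carrier_mat d d \<Longrightarrow> A * B \<in> carrier_mat d d"
  by (rule mult_carrier_mat)

lemma index_mult_sum:
  fixes A B :: "'a::comm_semiring_0 mat"
  assumes "A \<in> carrier_mat n m" "B \<in> carrier_mat m k" "i < n" "j < k"
  shows "(A * B) $$ (i, j) = (\<Sum>l<m. A $$ (i, l) * B $$ (l, j))"
  using assms by (auto simp: index_mult_mat(1) scalar_prod_def lessThan_atLeast0 intro!: sum.cong)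

lemma dagger_mult:
  assumes "A \<in> carrier_mat n m" "B \<in> carrier_mat m k"
  shows "dagger (A * B) = dagger B * dagger A"
proof (rule eq_matI)
  fix i j assume "i < dim_row (dagger B * dagger A)" "j < dim_col (dagger B * dagger A)"
  then have ij: "i < k" "j < n" using assms by auto
  have "dagger (A * B) $$ (i, j) = cnj ((A * B) $$ (j, i))" using ij assms by simp
  also have "\<dots> = (\<Sum>l<m. dagger B $$ (i, l) * dagger A $$ (l, j))"
    using ij assms by (auto simp: index_mult_sum[OF assms] mult.commute intro!: sum.cong)
  finally show "dagger (A * B) $$ (i, j) = (dagger B * dagger A) $$ (i, j)"
    using index_mult_sum[OF dagger_carrier[OF assms(2)] dagger_carrier[OF assms(1)]] ij by simp
qed (use assms in auto)

lemma diagm_carrier [simp, intro]: "diagm d f \<in> carrier_mat d d"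
  by (simp add: diagm_def)

section \<open>Unitary diagonalisation of Hermitian matrices\<close>

definition unitary :: "nat \<Rightarrow> complex mat \<Rightarrow> bool" where
  "unitary d U \<longleftrightarrow> U \<in> carrier_mat d d \<and> dagger U * U = 1\<^sub>m d"

lemma unitaryD:
  assumes "unitary d U"
  shows "U \<in> carrier_mat d d" "dagger U * U = 1\<^sub>m d" "U * dagger U = 1\<^sub>m d"
  using assms mat_mult_left_right_inverse[of "dagger U" d U] by (auto simp: unitary_def)

lemma unitary_mult:
  assumes "unitary d U" "unitary d V" shows "unitary d (U * V)"
proof -
  note U = unitaryD[OF assms(1)] and V = unitaryD[OF assms(2)]
  have "dagger (U * V) * (U * V) = dagger V * ((dagger U * U) * V)"
    using U(1) V(1) by (simp add: dagger_mult assoc_mult_mat[of _ d d _ d _ d])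
  then show ?thesis using U V by (simp add: unitary_def)
qed

lemma unitary_col_sum:
  assumes "unitary d U" "i < d" "j < d"
  shows "(\<Sum>a<d. cnj (U $$ (a, i)) * U $$ (a, j)) = (if i = j then 1 else 0)"
proof -
  note U = unitaryD[OF assms(1)]
  have "(dagger U * U) $$ (i, j) = (\<Sum>a<d. cnj (U $$ (a, i)) * U $$ (a, j))"
    using U(1) assms(2,3) by (auto simp: index_mult_sum[OF dagger_carrier[OF U(1)] U(1)] intro!: sum.cong)
  then show ?thesis using U assms by simp
qed

definition spectral :: "nat \<Rightarrow> complex mat \<Rightarrow> complex mat \<Rightarrow> (nat \<Rightarrow> real) \<Rightarrow> bool" where
  "spectral d M U p \<longleftrightarrow> unitary d U \<and> M = U * diagm d p * dagger U"

text \<open>Gram-Schmidt keeps the first vector of a basis completing v and yields orthogonal, not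
  orthonormal, vectors. Dividing each by its norm gives the columns, and c is the reciprocal norm of
  v.\<close>

lemma exists_unitary_first_col:
  assumes v: "v \<in> carrier_vec n" and v0: "v \<noteq> 0\<^sub>v n"
  shows "\<exists>W c. unitary n W \<and> c \<noteq> (0::complex) \<and> (\<forall>i<n. W $$ (i, 0) = c * v $ i)"
proof -
  interpret cof_vec_space n "TYPE(complex)" .
  define b where "b = basis_completion v"
  define ws where "ws = gram_schmidt n b"
  from basis_completion[OF v v0, folded b_def]
  have dist_b: "distinct b" and indep: "\<not> lin_dep (set b)" and b: "set b \<subseteq> carrier_vec n"
    and hdb: "hd b = v" and len_b: "length b = n" by auto
  have n: "0 < n" using v v0 by (cases n) auto
  with hdb len_b obtain vs where bv: "b = v # vs" by (cases b) auto
  from gram_schmidt_result[OF b dist_b indep refl, folded ws_def]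
  have ws: "set ws \<subseteq> carrier_vec n" "corthogonal ws" "length ws = n" by (auto simp: len_b)
  have hdws: "ws ! 0 = v"
    using gram_schmidt_hd[OF v, of vs, folded bv] ws(3) n
    by (metis hd_conv_nth length_greater_0_conv ws_def)
  have wc: "ws ! i \<in> carrier_vec n" if "i < n" for i using ws that by auto
  define N where "N i = (\<Sum>a<n. (cmod (ws ! i $ a))\<^sup>2)" for i
  have ip: "ws ! j \<bullet>c ws ! i = (\<Sum>a<n. cnj (ws ! i $ a) * ws ! j $ a)" if "i < n" "j < n" for i j
    using wc[OF that(1)] wc[OF that(2)]
    by (auto simp: scalar_prod_def lessThan_atLeast0 mult.commute intro!: sum.cong)
  have NN: "(\<Sum>a<n. cnj (ws ! i $ a) * ws ! i $ a) = of_real (N i)" for i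
    unfolding N_def by (simp add: complex_norm_square mult.commute del: of_real_power)
  have Npos: "0 < N i" if "i < n" for i
  proof -
    have "ws ! i \<bullet>c ws ! i \<noteq> 0" using corthogonalD[OF ws(2)] that ws(3) by auto
    then have "N i \<noteq> 0" using ip[OF that that] NN[of i] by auto
    moreover have "0 \<le> N i" unfolding N_def by (intro sum_nonneg) auto
    ultimately show ?thesis by simp
  qed
  define W where "W = mat n n (\<lambda>(a, i). ws ! i $ a / of_real (sqrt (N i)))"
  have W: "W \<in> carrier_mat n n" by (simp add: W_def)
  have "dagger W * W = 1\<^sub>m n"
  proof (rule eq_matI)
    fix i j assume "i < dim_row (1\<^sub>m n :: complex mat)" "j < dim_col (1\<^sub>m n :: complex mat)"
    then have ij: "i < n" "j < n" by auto
    have "(dagger W * W) $$ (i, j) = (\<Sum>a<n. cnj (ws ! i $ a) * ws ! j $ a / of_real (sqrt (N i) * sqrt (N j)))"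
      unfolding index_mult_sum[OF dagger_carrier[OF W] W ij]
      using ij by (auto simp: W_def intro!: sum.cong)
    also have "\<dots> = (\<Sum>a<n. cnj (ws ! i $ a) * ws ! j $ a) / of_real (sqrt (N i) * sqrt (N j))"
      by (simp add: sum_divide_distrib)
    also have "\<dots> = (if i = j then 1 else 0)"
    proof (cases "i = j")
      case True
      have "sqrt (N i) * sqrt (N j) = N i" using Npos[OF ij(1)] True by simp
      then show ?thesis using True Npos[OF ij(1)] NN[of i] by simp
    next
      case False
      then have "ws ! j \<bullet>c ws ! i = 0" using corthogonalD[OF ws(2)] ij ws(3) by auto
      then show ?thesis using False ip[OF ij] by simp
    qed
    finally show "(dagger W * W) $$ (i, j) = 1\<^sub>m n $$ (i, j)" using ij by simp
  qed (use W in auto)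
  moreover have "\<forall>i<n. W $$ (i, 0) = (1 / of_real (sqrt (N 0))) * v $ i"
    using n hdws by (simp add: W_def)
  moreover have "(1 / of_real (sqrt (N 0)) :: complex) \<noteq> 0" using Npos[OF n] by simp
  ultimately show ?thesis using W unfolding unitary_def by blast
qed

lemma unitary_conj_eq:
  assumes "unitary d W" "M \<in> carrier_mat d d" "G = dagger W * M * W"
  shows "M = W * G * dagger W"
proof -
  note W = unitaryD[OF assms(1)]
  have "W * G * dagger W = (W * dagger W) * M * (W * dagger W)"
    using W(1) assms(2) unfolding assms(3) by (simp add: assoc_mult_mat[of _ d d _ d _ d])
  then show ?thesis using W assms(2) by simp
qed

text \<open>Deflation by one eigenvector: rotating it to the first coordinate clears the first
  column below the diagonal, the Hermitian property clears the first row with it, and the remaining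
  block is again Hermitian.\<close>

theorem hermitian_spectral:
  assumes "M \<in> carrier_mat d d" "dagger M = M"
  shows "\<exists>U p. spectral d M U p"
  using assms
proof (induction d arbitrary: M)
  case 0
  have "unitary 0 (1\<^sub>m 0)" unfolding unitary_def by (auto intro!: eq_matI)
  moreover have "M = 1\<^sub>m 0 * diagm 0 undefined * dagger (1\<^sub>m 0)" using 0 by (auto intro!: eq_matI)
  ultimately show ?case unfolding spectral_def by blast
next
  case (Suc d)
  let ?n = "Suc d"
  note M = Suc.prems(1)
  from spectrum_non_empty[OF M] obtain e where "eigenvalue M e" by (auto simp: spectrum_def)
  then obtain v where v: "v \<in> carrier_vec ?n" "v \<noteq> 0\<^sub>v ?n" "M *\<^sub>v v = e \<cdot>\<^sub>v v"
    using M by (auto simp: eigenvalue_def eigenvector_def)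
  from exists_unitary_first_col[OF v(1,2)] obtain W c where W: "unitary ?n W" and c: "c \<noteq> 0"
    and Wv: "\<And>i. i < ?n \<Longrightarrow> W $$ (i, 0) = c * v $ i" by blast
  note W' = unitaryD[OF W]
  define G where "G = dagger W * M * W"
  have G: "G \<in> carrier_mat ?n ?n" using W' M by (simp add: G_def)
  have MG: "M = W * G * dagger W" by (rule unitary_conj_eq[OF W M G_def])
  have Gh: "dagger G = G"
    unfolding G_def using W'(1) M Suc.prems(2)
    by (simp add: dagger_mult[of _ ?n ?n _ ?n] assoc_mult_mat[of _ ?n ?n _ ?n _ ?n])
  have MW0: "(M * W) $$ (a, 0) = e * W $$ (a, 0)" if a: "a < ?n" for a
  proof -
    have "(M *\<^sub>v v) $ a = (\<Sum>l<?n. M $$ (a, l) * v $ l)"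
      using a M v(1) by (auto simp: scalar_prod_def lessThan_atLeast0 intro!: sum.cong)
    then have ev: "(\<Sum>l<?n. M $$ (a, l) * v $ l) = e * v $ a" using v a by simp
    have "(M * W) $$ (a, 0) = (\<Sum>l<?n. M $$ (a, l) * W $$ (l, 0))"
      using a by (simp add: index_mult_sum[OF M W'(1)])
    also have "\<dots> = (\<Sum>l<?n. c * (M $$ (a, l) * v $ l))"
      by (rule sum.cong) (auto simp: Wv)
    also have "\<dots> = c * (e * v $ a)" by (simp only: sum_distrib_left[symmetric] ev)
    finally show ?thesis using Wv[OF a] by simp
  qed
  have G0: "G $$ (i, 0) = (if i = 0 then e else 0)" if i: "i < ?n" for i
  proof -
    have "G = dagger W * (M * W)" unfolding G_def using W'(1) M by (simp add: assoc_mult_mat[of _ ?n ?n _ ?n _ ?n])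
    then have "G $$ (i, 0) = (\<Sum>a<?n. dagger W $$ (i, a) * (M * W) $$ (a, 0))"
      using index_mult_sum[of "dagger W" ?n ?n "M * W" ?n i 0] i W'(1) M by simp
    also have "\<dots> = (\<Sum>a<?n. e * (cnj (W $$ (a, i)) * W $$ (a, 0)))"
      using i W'(1) by (intro sum.cong) (auto simp: MW0)
    also have "\<dots> = e * (if i = 0 then 1 else 0)"
      by (simp only: sum_distrib_left[symmetric] unitary_col_sum[OF W i zero_less_Suc])
    finally show ?thesis by simp
  qed
  have Gsym: "G $$ (i, j) = cnj (G $$ (j, i))" if "i < ?n" "j < ?n" for i j
    using that G Gh index_dagger[of i G j] by simp
  \<comment> \<open>A diagonal entry of a Hermitian matrix is real, so e can be one of the real
    eigenvalues \<open>p\<close>.\<close>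
  have er: "e = of_real (Re e)"
    using Gsym[of 0 0] G0[of 0] by (simp add: complex_eq_iff)
  define B where "B = mat d d (\<lambda>(i, j). G $$ (Suc i, Suc j))"
  have B: "B \<in> carrier_mat d d" by (simp add: B_def)
  have "dagger B = B"
    by (rule eq_matI) (auto simp: B_def Gsym[symmetric])
  from Suc.IH[OF B this] obtain V q where V: "unitary d V" and BV: "B = V * diagm d q * dagger V"
    unfolding spectral_def by blast
  note V' = unitaryD[OF V]
  \<comment> \<open>The direct sum of 1 and \<open>V\<close> fixes the eigenvector already split off
    and diagonalises the rest; the eigenbasis of \<open>M\<close> is then
    \<open>W * F\<close>.\<close>
  define F where "F = four_block_mat (1\<^sub>m 1) (0\<^sub>m 1 d) (0\<^sub>m d 1) V"
  define p where "p i = (case i of 0 \<Rightarrow> Re e | Suc i \<Rightarrow> q i)" for i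
  have dag: "dagger F = four_block_mat (1\<^sub>m 1) (0\<^sub>m 1 d) (0\<^sub>m d 1) (dagger V)"
    unfolding F_def using V'(1) by (intro eq_matI) auto
  have Dp: "diagm ?n p = four_block_mat (e \<cdot>\<^sub>m 1\<^sub>m 1) (0\<^sub>m 1 d) (0\<^sub>m d 1) (diagm d q)"
    using er by (intro eq_matI) (auto simp: diagm_def p_def split: nat.splits)
  have FC: "F \<in> carrier_mat ?n ?n" unfolding F_def using V'(1)
    using four_block_carrier_mat[of "1\<^sub>m 1" 1 1 V d d] by simp
  have FF: "dagger F * F = 1\<^sub>m ?n"
    unfolding dag unfolding F_def using V'
    by (subst mult_four_block_mat[of _ 1 1 _ d _ d _ _ 1 _ d]) (auto intro!: eq_matI)
  have GF: "G = F * diagm ?n p * dagger F"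
  proof -
    have "F * diagm ?n p = four_block_mat (e \<cdot>\<^sub>m 1\<^sub>m 1) (0\<^sub>m 1 d) (0\<^sub>m d 1) (V * diagm d q)"
      unfolding Dp unfolding F_def using V'(1)
      by (subst mult_four_block_mat[of _ 1 1 _ d _ d _ _ 1 _ d])
         (auto simp: left_mult_zero_mat[OF diagm_carrier] right_mult_zero_mat)
    moreover have "V * diagm d q \<in> carrier_mat d d" using V'(1) by simp
    ultimately have "F * diagm ?n p * dagger F = four_block_mat (e \<cdot>\<^sub>m 1\<^sub>m 1) (0\<^sub>m 1 d) (0\<^sub>m d 1) B"
      unfolding dag BV using V'(1)
      by (simp, subst mult_four_block_mat[of _ 1 1 _ d _ d _ _ 1 _ d])
         (auto simp: left_mult_zero_mat[of _ d d] right_mult_zero_mat[of _ d d])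
    also have "\<dots> = G"
    proof (rule eq_matI)
      fix i j assume "i < dim_row G" "j < dim_col G"
      then have "i < ?n" "j < ?n" using G by auto
      then show "four_block_mat (e \<cdot>\<^sub>m 1\<^sub>m 1) (0\<^sub>m 1 d) (0\<^sub>m d 1) B $$ (i, j) = G $$ (i, j)"
        using B G0[of i] G0[of j] Gsym[of i j]
        by (cases i; cases j) (auto simp: B_def)
    qed (use G B in auto)
    finally show ?thesis by simp
  qed
  have "unitary ?n (W * F)" using unitary_mult[OF W] FC FF unfolding unitary_def by blast
  moreover have "M = (W * F) * diagm ?n p * dagger (W * F)"
    unfolding MG GF using W'(1) FC
    by (simp add: dagger_mult[of _ ?n ?n _ ?n] assoc_mult_mat[of _ ?n ?n _ ?n _ ?n])
  ultimately show ?case unfolding spectral_def by blast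
qed

lemma spectral_entry:
  assumes "spectral d M U p" "a < d" "b < d"
  shows "M $$ (a, b) = (\<Sum>i<d. of_real (p i) * (U $$ (a, i) * cnj (U $$ (b, i))))"
proof -
  from assms(1) have U: "U \<in> carrier_mat d d" and M: "M = U * diagm d p * dagger U"
    by (auto simp: spectral_def unitary_def)
  have UD: "(U * diagm d p) $$ (a, i) = of_real (p i) * U $$ (a, i)" if "i < d" for i
    unfolding index_mult_sum[OF U diagm_carrier assms(2) that]
    using that by (simp add: diagm_def if_distrib[of "\<lambda>x. _ * x"] sum.delta cong: if_cong)
  show ?thesis unfolding M
    using assms U by (subst index_mult_sum[of _ d d _ d]) (auto simp: UD intro!: sum.cong)
qed

text \<open>\<open>eigvals\<close> is an arbitrary choice among the lists that factor the
  characteristic polynomial. All of them agree as multisets, being the roots with multiplicity, and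
  the entropy sees only the multiset.\<close>

theorem vN_entropy_spectral:
  assumes "spectral d M U p"
  shows "vN_entropy d M = (\<Sum>i<d. eta (p i))"
proof -
  from assms have U: "unitary d U" and M: "M = U * diagm d p * dagger U" by (auto simp: spectral_def)
  note U' = unitaryD[OF U]
  have "similar_mat M (diagm d p)"
    unfolding similar_mat_def M
    by (rule exI[of _ U], rule exI[of _ "dagger U"], rule similar_mat_witI[of _ _ d]) (use U' in auto)
  then have "char_poly M = char_poly (diagm d p)" by (rule char_poly_similar)
  also have "\<dots> = (\<Prod>a\<leftarrow>diag_mat (diagm d p). [:- a, 1:])"
    by (rule char_poly_upper_triangular[OF diagm_carrier]) (auto simp: diagm_def upper_triangular_def)
  also have "diag_mat (diagm d p) = map (\<lambda>i. of_real (p i)) [0..<d]"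
    by (auto simp: diag_mat_def diagm_def)
  finally have cp: "char_poly M = (\<Prod>a\<leftarrow>map (\<lambda>i. of_real (p i)) [0..<d]. [:- a, 1:])" .
  let ?P = "\<lambda>as. length as = d \<and> char_poly M = (\<Prod>a\<leftarrow>as. [:- a, 1:])"
  have "?P (map (\<lambda>i. of_real (p i)) [0..<d])" using cp by simp
  then have "?P (eigvals d M)" unfolding eigvals_def by (rule someI)
  then have eq: "(\<Prod>a\<leftarrow>eigvals d M. [:- a, 1:]) = (\<Prod>a\<leftarrow>map (\<lambda>i. complex_of_real (p i)) [0..<d]. [:- a, 1:])"
    using cp by simp
  have pr: "proots (\<Prod>a\<leftarrow>as. [:- a, 1:]) = mset as" for as :: "complex list"
  proof (induction as)
    case (Cons a as)
    have "(\<Prod>a\<leftarrow>as. [:- a, 1:]) \<noteq> 0" by (auto simp: prod_list_zero_iff)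
    then show ?case using Cons by (simp add: proots_mult del: mult_pCons_left)
  qed simp
  have "mset (eigvals d M) = mset (map (\<lambda>i. complex_of_real (p i)) [0..<d])"
    using arg_cong[OF eq, of proots] unfolding pr .
  then have "(\<Sum>a\<leftarrow>eigvals d M. eta (Re a)) = (\<Sum>a\<leftarrow>map (\<lambda>i. complex_of_real (p i)) [0..<d]. eta (Re a))"
    by (simp only: sum_mset_sum_list[symmetric] mset_map)
  then show ?thesis unfolding vN_entropy_def
    by (simp add: lessThan_atLeast0 interv_sum_list_conv_sum_set_nat o_def)
qed

section \<open>Variational form of the relative entropy\<close>

lemma mtrace_mult_sum:
  assumes "A \<in> carrier_mat d d" "B \<in> carrier_mat d d"
  shows "mtrace d (A * B) = (\<Sum>i<d. \<Sum>j<d. A $$ (i, j) * B $$ (j, i))"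
  unfolding mtrace_def by (intro sum.cong refl) (simp add: index_mult_sum[OF assms])

lemma mtrace_mult_commute:
  assumes "A \<in> carrier_mat d d" "B \<in> carrier_mat d d"
  shows "mtrace d (A * B) = mtrace d (B * A)"
  unfolding mtrace_mult_sum[OF assms] mtrace_mult_sum[OF assms(2,1)]
  by (subst sum.swap) (simp add: mult.commute)

lemma mtrace_dagger: "A \<in> carrier_mat d d \<Longrightarrow> mtrace d (dagger A) = cnj (mtrace d A)"
  by (auto simp: mtrace_def)

section \<open>Quadratic forms and positive semidefinite matrices\<close>

definition qform :: "nat \<Rightarrow> complex mat \<Rightarrow> (nat \<Rightarrow> complex) \<Rightarrow> complex" where
  "qform d M v = (\<Sum>i<d. \<Sum>j<d. cnj (v i) * M $$ (i, j) * v j)"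

lemma psd_iff: "psd d M \<longleftrightarrow> M \<in> carrier_mat d d \<and> (\<forall>v. Im (qform d M v) = 0 \<and> 0 \<le> Re (qform d M v))"
  by (simp add: psd_def qform_def Let_def)

lemma psdD:
  assumes "psd d M"
  shows "M \<in> carrier_mat d d" "Im (qform d M v) = 0" "0 \<le> Re (qform d M v)"
  using assms by (auto simp: psd_iff)

lemma conj_diag_qform:
  assumes "M \<in> carrier_mat d d" "Y \<in> carrier_mat d d" "i < d"
  shows "(dagger Y * M * Y) $$ (i, i) = qform d M (\<lambda>a. Y $$ (a, i))"
proof -
  have "(dagger Y * M * Y) $$ (i, i) = (dagger Y * (M * Y)) $$ (i, i)"
    using assms by (simp add: assoc_mult_mat[of _ d d _ d _ d])
  also have "\<dots> = (\<Sum>a<d. dagger Y $$ (i, a) * (\<Sum>b<d. M $$ (a, b) * Y $$ (b, i)))"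
    using assms by (simp add: index_mult_sum[of _ d d _ d])
  also have "\<dots> = qform d M (\<lambda>a. Y $$ (a, i))"
    unfolding qform_def using assms by (auto simp: sum_distrib_left mult.assoc intro!: sum.cong)
  finally show ?thesis .
qed

lemma qform_two:
  assumes "i < d" "j < d" "i \<noteq> j"
  shows "qform d M (\<lambda>a. if a = i then x else if a = j then y else 0) =
    cnj x * M $$ (i, i) * x + cnj x * M $$ (i, j) * y + cnj y * M $$ (j, i) * x + cnj y * M $$ (j, j) * y"
proof -
  let ?v = "\<lambda>a. if a = i then x else if a = j then y else 0"
  have S: "(\<Sum>b<d. f b * ?v b) = f i * x + f j * y" for f :: "nat \<Rightarrow> complex"
  proof -
    have "(\<Sum>b<d. f b * ?v b) = (\<Sum>b\<in>{i,j}. f b * ?v b)"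
      using assms by (intro sum.mono_neutral_right) auto
    then show ?thesis using assms by simp
  qed
  have "qform d M ?v = (\<Sum>a<d. cnj (?v a) * (M $$ (a, i) * x + M $$ (a, j) * y))"
    unfolding qform_def by (intro sum.cong refl) (simp only: mult.assoc sum_distrib_left[symmetric] S)
  also have "\<dots> = (\<Sum>a\<in>{i,j}. cnj (?v a) * (M $$ (a, i) * x + M $$ (a, j) * y))"
    using assms by (intro sum.mono_neutral_right) auto
  finally show ?thesis using assms by (simp add: algebra_simps)
qed

lemma qform_one:
  assumes "i < d"
  shows "qform d M (\<lambda>a. if a = i then 1 else 0) = M $$ (i, i)"
  unfolding qform_def using assms
  by (simp add: if_distrib[of "\<lambda>x. _ * x"] if_distrib[of cnj] if_distrib[of "\<lambda>x. x * _"] sum.delta cong: if_cong)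

text \<open>Polarisation: the form is real at e_i, at e_i + e_j and at e_i + \<i> e_j, which settles
  the diagonal, then the imaginary and the real part of an off-diagonal pair.\<close>

lemma psd_hermitian:
  assumes "psd d M" shows "dagger M = M"
proof (rule eq_matI)
  note M = psdD[OF assms]
  fix i j assume "i < dim_row M" "j < dim_col M"
  then have ij: "i < d" "j < d" using M(1) by auto
  have Di: "Im (M $$ (a, a)) = 0" if "a < d" for a
    using M(2)[of "\<lambda>b. if b = a then 1 else 0"] qform_one[OF that] by simp
  have "M $$ (i, j) = cnj (M $$ (j, i))"
  proof (cases "i = j")
    case True then show ?thesis using Di ij by (simp add: complex_eq_iff)
  next
    case False
    have "Im (M $$ (i, j)) + Im (M $$ (j, i)) = 0"
      using M(2)[of "\<lambda>a. if a = i then 1 else if a = j then 1 else 0"] qform_two[OF ij False, of M 1 1] Di ij by simp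
    moreover have "Re (M $$ (i, j)) - Re (M $$ (j, i)) = 0"
      using M(2)[of "\<lambda>a. if a = i then 1 else if a = j then \<i> else 0"] qform_two[OF ij False, of M 1 \<i>] Di ij by simp
    ultimately show ?thesis by (simp add: complex_eq_iff)
  qed
  then show "dagger M $$ (i, j) = M $$ (i, j)" using ij M(1) by simp
qed (use psdD(1)[OF assms] in auto)

lemma unitary_cancel:
  assumes "unitary d U" "Z \<in> carrier_mat d d"
  shows "dagger U * (U * Z) = Z" "U * (dagger U * Z) = Z"
  using unitaryD[OF assms(1)] assms(2) by (simp_all add: assoc_mult_mat[of _ d d _ d _ d, symmetric])

lemma mtrace_unitary_conj:
  assumes "unitary d U" "Z \<in> carrier_mat d d"
  shows "mtrace d (U * Z * dagger U) = mtrace d Z"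
  using unitaryD[OF assms(1)] assms mtrace_mult_commute[of "U * Z" d "dagger U"] by (simp add: unitary_cancel)

lemma spectralD:
  assumes "spectral d M U p"
  shows "unitary d U" "U \<in> carrier_mat d d" "M \<in> carrier_mat d d" "M = U * diagm d p * dagger U"
    "dagger U * M * U = diagm d p"
proof -
  show U: "unitary d U" and M: "M = U * diagm d p * dagger U" using assms by (auto simp: spectral_def)
  show U': "U \<in> carrier_mat d d" using unitaryD[OF U] by simp
  show "M \<in> carrier_mat d d" unfolding M using U' by simp
  show "dagger U * M * U = diagm d p" unfolding M using U' unitaryD(2)[OF U] unitary_cancel[OF U]
    by (simp add: assoc_mult_mat[of _ d d _ d _ d] right_mult_one_mat[of _ d d])
qed

text \<open>One diagonalisation is chosen for each matrix. \<open>eigvec\<close> and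
  \<open>eigval\<close> project the same chosen pair, so the i-th column belongs to the i-th value;
  where no diagonalisation exists the values are arbitrary.\<close>

definition eigvec :: "nat \<Rightarrow> complex mat \<Rightarrow> complex mat" where
  "eigvec d M = fst (SOME (U, p). spectral d M U p)"
definition eigval :: "nat \<Rightarrow> complex mat \<Rightarrow> nat \<Rightarrow> real" where
  "eigval d M = snd (SOME (U, p). spectral d M U p)"

lemma psd_spectral:
  assumes "psd d M" shows "spectral d M (eigvec d M) (eigval d M)"
proof -
  have "\<exists>U p. spectral d M U p" using hermitian_spectral psdD(1)[OF assms] psd_hermitian[OF assms] by blast
  then show ?thesis unfolding eigvec_def eigval_def
    by (metis (mono_tags, lifting) case_prodE case_prodI fst_conv snd_conv someI)
qed

lemma psd_eigval_nonneg:
  assumes "psd d M" "i < d" shows "0 \<le> eigval d M i"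
proof -
  note S = spectralD[OF psd_spectral[OF assms(1)]]
  have "complex_of_real (eigval d M i) = qform d M (\<lambda>a. eigvec d M $$ (a, i))"
    using conj_diag_qform[OF S(3,2) assms(2)] S(5) assms(2) by (simp add: diagm_def)
  then show ?thesis using psdD(3)[OF assms(1)] by (metis Re_complex_of_real)
qed

text \<open>For positive definite arguments the supremum over X is the quadratic form of
  (L + t R)^(-1) at \<rho>, where L and R multiply by \<sigma> on the left and by \<rho> on the right;
  integrating it over t gives the relative entropy.\<close>
definition varf :: "nat \<Rightarrow> real \<Rightarrow> complex mat \<Rightarrow> complex mat \<Rightarrow> complex mat \<Rightarrow> real" where
  "varf d t X \<rho> \<sigma> = 2 * Re (mtrace d (dagger X * \<rho>)) - Re (mtrace d (\<sigma> * (X * dagger X)))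
     - t * Re (mtrace d (\<rho> * (dagger X * X)))"

text \<open>The Nussbaum-Szkola weights |<v_j, u_i>|^2 for the chosen eigenvectors u_i of \<rho> and
  v_j of \<sigma>. For states, multiplying them by the eigenvalues of \<rho> or of \<sigma> gives
  two classical distributions with the same relative entropy as the pair.\<close>

definition overlap :: "nat \<Rightarrow> complex mat \<Rightarrow> complex mat \<Rightarrow> nat \<Rightarrow> nat \<Rightarrow> real" where
  "overlap d \<rho> \<sigma> i j = (cmod ((dagger (eigvec d \<sigma>) * eigvec d \<rho>) $$ (j, i)))\<^sup>2"

text \<open>Sandwiched between the two eigenbases, the test operator meets \<sigma> on the left and
  \<rho> on the right as diagonal matrices, so the functional decouples into one quadratic for each
  entry of \<open>Y\<close>.\<close>

lemma varf_spectral: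
  assumes "spectral d \<rho> U p" "spectral d \<sigma> V q" "Y \<in> carrier_mat d d"
  shows "varf d t (V * Y * dagger U) \<rho> \<sigma> =
    (\<Sum>i<d. \<Sum>j<d. 2 * p i * Re (cnj (Y $$ (j, i)) * (dagger V * U) $$ (j, i)) - (q j + t * p i) * (cmod (Y $$ (j, i)))\<^sup>2)"
proof -
  note SU = spectralD[OF assms(1)] and SV = spectralD[OF assms(2)]
  note cU = unitary_cancel[OF SU(1)] and cV = unitary_cancel[OF SV(1)]
  have YC: "Y \<in> carrier_mat d d" "dagger Y \<in> carrier_mat d d" "diagm d p \<in> carrier_mat d d" "diagm d q \<in> carrier_mat d d"
    using assms by auto
  have assoc: "A * B * C = A * (B * C)" if "A \<in> carrier_mat d d" "B \<in> carrier_mat d d" "C \<in> carrier_mat d d" for A B C :: "complex mat"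
    using that by (rule assoc_mult_mat)
  define X where "X = V * Y * dagger U"
  have dX: "dagger X = U * dagger Y * dagger V"
    unfolding X_def using SU(2) SV(2) YC by (simp add: dagger_mult[of _ d d _ d] assoc)
  have "dagger X * \<rho> = U * (dagger Y * (dagger V * U) * diagm d p) * dagger U"
    unfolding dX SU(4) using SU(2) SV(2) YC by (simp add: assoc)
  then have "mtrace d (dagger X * \<rho>) = mtrace d (dagger Y * (dagger V * U) * diagm d p)"
    using mtrace_unitary_conj[OF SU(1)] SU(2) SV(2) YC by simp
  also have "\<dots> = mtrace d (diagm d p * (dagger Y * (dagger V * U)))"
    using SU(2) SV(2) YC by (intro mtrace_mult_commute) auto
  also have "\<dots> = (\<Sum>i<d. of_real (p i) * (dagger Y * (dagger V * U)) $$ (i, i))"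
    using SU(2) SV(2) YC by (simp add: mtrace_mult_sum diagm_def if_distrib[of "\<lambda>x. x * _"] sum.delta cong: if_cong)
  also have "\<dots> = (\<Sum>i<d. \<Sum>j<d. of_real (p i) * (cnj (Y $$ (j, i)) * (dagger V * U) $$ (j, i)))"
    using SU(2) SV(2) YC
    by (intro sum.cong refl, subst index_mult_sum[of _ d d _ d]) (auto simp: sum_distrib_left intro!: sum.cong)
  finally have 1: "Re (mtrace d (dagger X * \<rho>)) = (\<Sum>i<d. \<Sum>j<d. p i * Re (cnj (Y $$ (j, i)) * (dagger V * U) $$ (j, i)))"
    by (simp only: Re_sum) simp
  have "\<sigma> * (X * dagger X) = V * (diagm d q * (Y * dagger Y)) * dagger V"
    unfolding dX unfolding X_def SV(4) using SU(2) SV(2) YC by (simp add: assoc cU cV)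
  then have "mtrace d (\<sigma> * (X * dagger X)) = mtrace d (diagm d q * (Y * dagger Y))"
    using mtrace_unitary_conj[OF SV(1)] SU(2) SV(2) YC by simp
  also have "\<dots> = (\<Sum>j<d. of_real (q j) * (Y * dagger Y) $$ (j, j))"
    using YC by (simp add: mtrace_mult_sum diagm_def if_distrib[of "\<lambda>x. x * _"] sum.delta cong: if_cong)
  also have "\<dots> = (\<Sum>j<d. \<Sum>i<d. of_real (q j * (cmod (Y $$ (j, i)))\<^sup>2))"
    using YC assms(3) by (intro sum.cong refl, subst index_mult_sum[of _ d d _ d])
      (auto simp: sum_distrib_left complex_norm_square simp del: of_real_power intro!: sum.cong)
  finally have 2: "Re (mtrace d (\<sigma> * (X * dagger X))) = (\<Sum>i<d. \<Sum>j<d. q j * (cmod (Y $$ (j, i)))\<^sup>2)"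
    by (subst sum.swap) (simp add: Re_sum)
  have "\<rho> * (dagger X * X) = U * (diagm d p * (dagger Y * Y)) * dagger U"
    unfolding dX unfolding X_def SU(4) using SU(2) SV(2) YC by (simp add: assoc cU cV)
  then have "mtrace d (\<rho> * (dagger X * X)) = mtrace d (diagm d p * (dagger Y * Y))"
    using mtrace_unitary_conj[OF SU(1)] SU(2) SV(2) YC by simp
  also have "\<dots> = (\<Sum>i<d. of_real (p i) * (dagger Y * Y) $$ (i, i))"
    using YC by (simp add: mtrace_mult_sum diagm_def if_distrib[of "\<lambda>x. x * _"] sum.delta cong: if_cong)
  also have "\<dots> = (\<Sum>i<d. \<Sum>j<d. of_real (p i * (cmod (Y $$ (j, i)))\<^sup>2))"
    using YC assms(3) by (intro sum.cong refl, subst index_mult_sum[of _ d d _ d])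
      (auto simp: sum_distrib_left complex_norm_square mult.commute mult.left_commute simp del: of_real_power intro!: sum.cong)
  finally have 3: "Re (mtrace d (\<rho> * (dagger X * X))) = (\<Sum>i<d. \<Sum>j<d. p i * (cmod (Y $$ (j, i)))\<^sup>2)"
    by (simp add: Re_sum)
  show ?thesis unfolding X_def[symmetric] varf_def 1 2 3
    by (simp add: sum_distrib_left sum_subtractf sum.distrib algebra_simps)
qed

text \<open>Closed form of the maximum of varf over X. A denominator vanishes only together with its
  numerator, where 0 / 0 = 0 is the right value.\<close>
definition varmax :: "nat \<Rightarrow> real \<Rightarrow> complex mat \<Rightarrow> complex mat \<Rightarrow> real" where
  "varmax d t \<rho> \<sigma> = (\<Sum>(i, j)\<in>{..<d} \<times> {..<d}.
     overlap d \<rho> \<sigma> i j * ((eigval d \<rho> i)\<^sup>2 / (eigval d \<sigma> j + t * eigval d \<rho> i)))"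

text \<open>Completing the square with c = q + t p: once \<open>Re (cnj y * w)\<close> is replaced
  by |y| |w|, the gap is (c |y| - p |w|)^2 / c. If p = 0 the right side is 0 and the left is - q
  |y|^2.\<close>

lemma quadratic_bound:
  fixes y w :: complex and p q t :: real
  assumes "0 \<le> p" "0 \<le> q" "0 < t"
  shows "2 * p * Re (cnj y * w) - (q + t * p) * (cmod y)\<^sup>2 \<le> (cmod w)\<^sup>2 * (p\<^sup>2 / (q + t * p))"
proof (cases "p = 0")
  case True then show ?thesis using assms by simp
next
  case False
  define c where "c = q + t * p"
  have c: "0 < c" unfolding c_def using False assms by (simp add: add_nonneg_pos)
  have "Re (cnj y * w) \<le> cmod y * cmod w"
    by (metis complex_Re_le_cmod complex_mod_cnj norm_mult)
  then have "2 * p * Re (cnj y * w) \<le> 2 * p * (cmod y * cmod w)" using assms by (simp add: mult_left_mono)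
  moreover have "0 \<le> (c * cmod y - p * cmod w)\<^sup>2 / c" using c by simp
  moreover have "(c * cmod y - p * cmod w)\<^sup>2 / c = c * (cmod y)\<^sup>2 - 2 * p * (cmod y * cmod w) + (cmod w)\<^sup>2 * (p\<^sup>2 / c)"
    using c by (simp add: power2_eq_square field_simps)
  ultimately show ?thesis unfolding c_def by linarith
qed

lemma varf_le_varmax:
  assumes "psd d \<rho>" "psd d \<sigma>" "0 < t" "X \<in> carrier_mat d d"
  shows "varf d t X \<rho> \<sigma> \<le> varmax d t \<rho> \<sigma>"
proof -
  let ?U = "eigvec d \<rho>" and ?V = "eigvec d \<sigma>"
  note SU = psd_spectral[OF assms(1)] and SV = psd_spectral[OF assms(2)]
  note U = spectralD(1,2)[OF SU] and V = spectralD(1,2)[OF SV]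
  define Y where "Y = dagger ?V * X * ?U"
  have Y: "Y \<in> carrier_mat d d" unfolding Y_def using assms(4) U V by auto
  have "?V * Y * dagger ?U = (?V * dagger ?V) * X * (?U * dagger ?U)"
    unfolding Y_def using U V assms(4) by (simp add: assoc_mult_mat[of _ d d _ d _ d])
  then have X: "X = ?V * Y * dagger ?U" using unitaryD(3)[OF U(1)] unitaryD(3)[OF V(1)] assms(4) by simp
  show ?thesis
    unfolding X varf_spectral[OF SU SV Y] varmax_def sum.cartesian_product overlap_def
    using psd_eigval_nonneg[OF assms(1)] psd_eigval_nonneg[OF assms(2)] assms(3)
    by (intro sum_mono) (auto simp del: times_complex.sel complex_cnj_mult times_divide_eq_right intro!: quadratic_bound)
qed

lemma varmax_attained:
  assumes "psd d \<rho>" "psd d \<sigma>" "0 < t"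
  shows "\<exists>X\<in>carrier_mat d d. varf d t X \<rho> \<sigma> = varmax d t \<rho> \<sigma>"
proof -
  let ?U = "eigvec d \<rho>" and ?V = "eigvec d \<sigma>" and ?p = "eigval d \<rho>" and ?q = "eigval d \<sigma>"
  note SU = psd_spectral[OF assms(1)] and SV = psd_spectral[OF assms(2)]
  note U = spectralD(1,2)[OF SU] and V = spectralD(1,2)[OF SV]
  \<comment> \<open>The stationary point y = p w / (q + t p) of each quadratic. When the denominator
    vanishes, p and q vanish too and division by zero makes the entry 0.\<close>
  define Y where "Y = mat d d (\<lambda>(j, i). of_real (?p i / (?q j + t * ?p i)) * (dagger ?V * ?U) $$ (j, i))"
  have Y: "Y \<in> carrier_mat d d" by (simp add: Y_def)
  have "varf d t (?V * Y * dagger ?U) \<rho> \<sigma> = varmax d t \<rho> \<sigma>"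
    unfolding varf_spectral[OF SU SV Y] varmax_def sum.cartesian_product overlap_def
  proof (intro sum.cong refl, clarify)
    fix i j assume ij: "i < d" "j < d"
    define c where "c = ?q j + t * ?p i"
    let ?w = "(dagger ?V * ?U) $$ (j, i)"
    have Yji: "Y $$ (j, i) = of_real (?p i / c) * ?w" using ij by (simp add: Y_def c_def)
    have "Re (cnj (Y $$ (j, i)) * ?w) = ?p i / c * (cmod ?w)\<^sup>2"
      unfolding Yji by (simp add: cmod_power2) (simp add: power2_eq_square algebra_simps add_divide_distrib)
    moreover have "(cmod (Y $$ (j, i)))\<^sup>2 = (?p i / c)\<^sup>2 * (cmod ?w)\<^sup>2"
      unfolding Yji by (simp add: norm_mult norm_divide power_mult_distrib power_divide)
    ultimately have "2 * ?p i * Re (cnj (Y $$ (j, i)) * ?w) - c * (cmod (Y $$ (j, i)))\<^sup>2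
      = 2 * ?p i * (?p i / c * (cmod ?w)\<^sup>2) - c * ((?p i / c)\<^sup>2 * (cmod ?w)\<^sup>2)" by (simp only:)
    also have "\<dots> = (cmod ?w)\<^sup>2 * ((?p i)\<^sup>2 / c)"
      by (cases "c = 0") (auto simp: power2_eq_square field_simps)
    finally show "2 * ?p i * Re (cnj (Y $$ (j, i)) * ?w) - (?q j + t * ?p i) * (cmod (Y $$ (j, i)))\<^sup>2
      = (cmod ?w)\<^sup>2 * ((?p i)\<^sup>2 / (?q j + t * ?p i))"
      unfolding c_def .
  qed
  then show ?thesis using U V Y by (intro bexI[of _ "?V * Y * dagger ?U"]) auto
qed

text \<open>Integrates an inequality between sums of p^2/(q + t p) over t > 0, using
  that p ln (q + t p) has this derivative and is p ln t + p ln p + o(1) at infinity.\<close>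
lemma sum_log_ratio_mono:
  fixes w p q :: "'a \<Rightarrow> real" and w' p' q' :: "'b \<Rightarrow> real"
  assumes "finite K" "finite L"
    and K: "\<And>k. k \<in> K \<Longrightarrow> 0 \<le> w k \<and> 0 \<le> p k \<and> 0 \<le> q k \<and> (0 < w k \<and> 0 < p k \<longrightarrow> 0 < q k)"
    and L: "\<And>k. k \<in> L \<Longrightarrow> 0 \<le> w' k \<and> 0 \<le> p' k \<and> 0 \<le> q' k \<and> (0 < w' k \<and> 0 < p' k \<longrightarrow> 0 < q' k)"
    and tot: "(\<Sum>k\<in>K. w k * p k) = (\<Sum>k\<in>L. w' k * p' k)"
    and le: "\<And>t. 0 < t \<Longrightarrow> (\<Sum>k\<in>L. w' k * ((p' k)\<^sup>2 / (q' k + t * p' k))) \<le> (\<Sum>k\<in>K. w k * ((p k)\<^sup>2 / (q k + t * p k)))"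
  shows "(\<Sum>k\<in>L. w' k * (p' k * (ln (p' k) - ln (q' k)))) \<le> (\<Sum>k\<in>K. w k * (p k * (ln (p k) - ln (q k))))"
proof -
  define g where "g w p q t = w * (p * ln (q + t * p))" for w p q t :: real
  have der: "(g w p q has_real_derivative w * (p\<^sup>2 / (q + t * p))) (at t)"
    if "0 \<le> t" "0 \<le> w \<and> 0 \<le> p \<and> 0 \<le> q \<and> (0 < w \<and> 0 < p \<longrightarrow> 0 < q)" for w p q t
  proof (cases "w = 0 \<or> p = 0")
    case True
    then have "g w p q = (\<lambda>t. 0)" by (auto simp: g_def)
    then show ?thesis using True by auto
  next
    case False
    \<comment> \<open>At t = 0 only q is left, so differentiability at the endpoint is where the
      support condition enters.\<close>
    then have "0 < q + t * p" using that by (simp add: add_pos_nonneg)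
    then show ?thesis unfolding g_def
      by (auto intro!: derivative_eq_intros simp: power2_eq_square)
  qed
  have lim: "((\<lambda>t. g w p q t - w * p * ln t) \<longlongrightarrow> w * (p * ln p)) at_top"
    if "0 \<le> w \<and> 0 \<le> p \<and> 0 \<le> q \<and> (0 < w \<and> 0 < p \<longrightarrow> 0 < q)" for w p q
  proof (cases "w = 0 \<or> p = 0")
    case True then show ?thesis by (auto simp: g_def)
  next
    case False
    then have wpq: "0 < w" "0 < p" "0 < q" using that by auto
    have "((\<lambda>t. q / t + p) \<longlongrightarrow> 0 + p) at_top"
      by (intro tendsto_intros tendsto_divide_0[OF tendsto_const] filterlim_at_top_imp_at_infinity filterlim_ident)
    then have "((\<lambda>t. w * (p * ln (q / t + p))) \<longlongrightarrow> w * (p * ln p)) at_top"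
      using wpq by (intro tendsto_intros) auto
    moreover have "\<forall>\<^sub>F t in at_top. w * (p * ln (q / t + p)) = g w p q t - w * p * ln t"
      using eventually_gt_at_top[of 0]
    proof eventually_elim
      case (elim t)
      have "q / t + p = (q + t * p) / t" using elim by (simp add: field_simps)
      moreover have "0 < q + t * p" using elim wpq by (simp add: add_pos_pos)
      ultimately show ?case using elim by (simp add: g_def ln_div algebra_simps)
    qed
    ultimately show ?thesis by (rule Lim_transform_eventually)
  qed
  \<comment> \<open>Difference of the two antiderivatives. Its derivative is nonnegative by
    \<open>le\<close>. The value \<open>h 0\<close> collects the terms with \<open>ln (q k)\<close>
    and the limit at infinity those with \<open>ln (p k)\<close>, so \<open>h 0\<close> \<le> limit
    is the claim rearranged.\<close>
  define h where "h t = (\<Sum>k\<in>K. g (w k) (p k) (q k) t) - (\<Sum>k\<in>L. g (w' k) (p' k) (q' k) t)" for t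
  have dh: "(h has_real_derivative (\<Sum>k\<in>K. w k * ((p k)\<^sup>2 / (q k + t * p k))) - (\<Sum>k\<in>L. w' k * ((p' k)\<^sup>2 / (q' k + t * p' k)))) (at t)"
    if "0 \<le> t" for t
    unfolding h_def[abs_def] using that by (intro DERIV_diff DERIV_sum der K L)
  have mono: "h 0 \<le> h t" if "0 < t" for t
  proof (rule DERIV_nonneg_imp_increasing_open[of 0 t h])
    show "\<exists>y. DERIV h x :> y \<and> 0 \<le> y" if "0 < x" for x
      using dh[of x] le[of x] that by (intro exI conjI) auto
    show "continuous_on {0..t} h"
      by (rule continuous_at_imp_continuous_on) (auto intro!: DERIV_isCont dh)
  qed (use that in simp)
  have "((\<lambda>t. (\<Sum>k\<in>K. g (w k) (p k) (q k) t - w k * p k * ln t) - (\<Sum>k\<in>L. g (w' k) (p' k) (q' k) t - w' k * p' k * ln t))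
     \<longlongrightarrow> (\<Sum>k\<in>K. w k * (p k * ln (p k))) - (\<Sum>k\<in>L. w' k * (p' k * ln (p' k)))) at_top"
    by (intro tendsto_diff tendsto_sum lim K L)
  \<comment> \<open>Each sum of antiderivatives grows like its total weight times
    \<open>ln t\<close>; equal totals make these terms cancel.\<close>
  moreover have "(\<Sum>k\<in>K. g (w k) (p k) (q k) t - w k * p k * ln t) - (\<Sum>k\<in>L. g (w' k) (p' k) (q' k) t - w' k * p' k * ln t) = h t" for t
    using tot by (simp add: h_def sum_subtractf sum_distrib_right[symmetric])
  ultimately have "(h \<longlongrightarrow> (\<Sum>k\<in>K. w k * (p k * ln (p k))) - (\<Sum>k\<in>L. w' k * (p' k * ln (p' k)))) at_top" by simp
  then have "h 0 \<le> (\<Sum>k\<in>K. w k * (p k * ln (p k))) - (\<Sum>k\<in>L. w' k * (p' k * ln (p' k)))"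
    by (rule tendsto_lowerbound) (use mono in \<open>auto intro: eventually_mono[OF eventually_gt_at_top[of 0]]\<close>)
  then show ?thesis unfolding h_def g_def
    by (simp add: algebra_simps sum_subtractf)
qed

section \<open>Schwarz inequality for channels\<close>

lemma sum_product_index:
  fixes f :: "nat \<Rightarrow> 'a::comm_monoid_add"
  shows "(\<Sum>i<k * d. f i) = (\<Sum>r<k. \<Sum>a<d. f (r * d + a))"
proof -
  have "(\<Sum>i<k * d. f i) = (\<Sum>r<k. sum f {r * d..<r * d + d})" by (rule sum.nat_group[symmetric])
  also have "\<dots> = (\<Sum>r<k. \<Sum>a<d. f (r * d + a))"
  proof (rule sum.cong[OF refl])
    fix r
    show "sum f {r * d..<r * d + d} = (\<Sum>a<d. f (r * d + a))"
      using sum.shift_bounds_nat_ivl[of f 0 "r * d" d] by (simp add: lessThan_atLeast0 add.commute)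
  qed
  finally show ?thesis .
qed

section \<open>Linear structure of channels and the trace adjoint\<close>

definition matrix_unit :: "nat \<Rightarrow> nat \<Rightarrow> nat \<Rightarrow> complex mat" where
  "matrix_unit d a b = mat d d (\<lambda>(i, j). if i = a \<and> j = b then 1 else 0)"

lemma matrix_unit_carrier [simp, intro]: "matrix_unit d a b \<in> carrier_mat d d"
  by (simp add: matrix_unit_def)

lemma channelD:
  assumes "channel din dout \<Phi>"
  shows "X \<in> carrier_mat din din \<Longrightarrow> \<Phi> X \<in> carrier_mat dout dout"
    and "X \<in> carrier_mat din din \<Longrightarrow> Y \<in> carrier_mat din din \<Longrightarrow> \<Phi> (c \<cdot>\<^sub>m X + Y) = c \<cdot>\<^sub>m \<Phi> X + \<Phi> Y"
    and "X \<in> carrier_mat din din \<Longrightarrow> mtrace dout (\<Phi> X) = mtrace din X"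
    and "psd (k * din) X' \<Longrightarrow> psd (k * dout) (id_tensor k din dout \<Phi> X')"
  using assms unfolding channel_def by auto

text \<open>The channel axiom gives linearity for two-term combinations, so the matrix is assembled
  one entry at a time: \<open>part S\<close> keeps the entries in \<open>S\<close>, and the
  induction is on \<open>S\<close>.\<close>

lemma channel_entry:
  assumes ch: "channel din dout \<Phi>" and X: "X \<in> carrier_mat din din" and kl: "k < dout" "l < dout"
  shows "\<Phi> X $$ (k, l) = (\<Sum>a<din. \<Sum>b<din. X $$ (a, b) * \<Phi> (matrix_unit din a b) $$ (k, l))"
proof -
  define part where "part S = mat din din (\<lambda>ij. if ij \<in> S then X $$ ij else 0)" for S
  have pc: "part S \<in> carrier_mat din din" for S by (simp add: part_def)
  note C = channelD(1)[OF ch]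
  have "\<Phi> (part S) $$ (k, l) = (\<Sum>(a, b)\<in>S. X $$ (a, b) * \<Phi> (matrix_unit din a b) $$ (k, l))"
    if "finite S" "S \<subseteq> {..<din} \<times> {..<din}" for S
    using that
  proof (induction S)
    case empty
    \<comment> \<open>Linearity in this combined form yields \<Phi>(0) = 0 by taking the coefficient
      -1 at the zero matrix.\<close>
    have "\<Phi> ((-1) \<cdot>\<^sub>m part {} + part {}) = (-1) \<cdot>\<^sub>m \<Phi> (part {}) + \<Phi> (part {})"
      by (rule channelD(2)[OF ch pc pc])
    moreover have "(-1) \<cdot>\<^sub>m part {} + part {} = part {}" by (rule eq_matI) (auto simp: part_def)
    ultimately have "\<Phi> (part {}) $$ (k, l) = ((-1) \<cdot>\<^sub>m \<Phi> (part {}) + \<Phi> (part {})) $$ (k, l)" by simp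
    moreover have "((-1) \<cdot>\<^sub>m A + A) $$ (k, l) = 0" if "A \<in> carrier_mat dout dout" for A :: "complex mat"
      using that kl by simp
    ultimately show ?case using C[OF pc] by simp
  next
    case (insert ab S)
    obtain a b where ab: "ab = (a, b)" by force
    have "part (insert ab S) = X $$ (a, b) \<cdot>\<^sub>m matrix_unit din a b + part S"
      using insert(2,4) by (intro eq_matI) (auto simp: part_def matrix_unit_def ab)
    then have "\<Phi> (part (insert ab S)) = X $$ (a, b) \<cdot>\<^sub>m \<Phi> (matrix_unit din a b) + \<Phi> (part S)"
      using channelD(2)[OF ch _ pc] by simp
    then show ?case using insert C[OF pc, of S] C[OF matrix_unit_carrier, of a b] kl by (simp add: ab)
  qed
  from this[of "{..<din} \<times> {..<din}"]
  have "\<Phi> (part ({..<din} \<times> {..<din})) $$ (k, l)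
      = (\<Sum>a<din. \<Sum>b<din. X $$ (a, b) * \<Phi> (matrix_unit din a b) $$ (k, l))"
    by (simp add: sum.cartesian_product)
  moreover have "part ({..<din} \<times> {..<din}) = X" using X by (intro eq_matI) (auto simp: part_def)
  ultimately show ?thesis by simp
qed

text \<open>The Heisenberg picture: the adjoint for the bilinear pairing Tr(Y X), without complex
  conjugation. Row and column are swapped because pairing with the matrix unit at (a, b) reads off
  the entry (b, a).\<close>

definition adjoint_map :: "nat \<Rightarrow> nat \<Rightarrow> (complex mat \<Rightarrow> complex mat) \<Rightarrow> complex mat \<Rightarrow> complex mat" where
  "adjoint_map din dout \<Phi> Y = mat din din (\<lambda>(b, a). mtrace dout (Y * \<Phi> (matrix_unit din a b)))"

lemma adjoint_map_carrier [simp, intro]: "adjoint_map din dout \<Phi> Y \<in> carrier_mat din din"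
  by (simp add: adjoint_map_def)

lemma mtrace_adjoint_map:
  assumes ch: "channel din dout \<Phi>" and X: "X \<in> carrier_mat din din" and Y: "Y \<in> carrier_mat dout dout"
  shows "mtrace dout (Y * \<Phi> X) = mtrace din (adjoint_map din dout \<Phi> Y * X)"
proof -
  let ?E = "matrix_unit din"
  note C = channelD(1)[OF ch]
  have "mtrace din (adjoint_map din dout \<Phi> Y * X) = (\<Sum>b<din. \<Sum>a<din. mtrace dout (Y * \<Phi> (?E a b)) * X $$ (a, b))"
    unfolding mtrace_mult_sum[OF adjoint_map_carrier X] by (auto simp: adjoint_map_def)
  also have "\<dots> = (\<Sum>a<din. \<Sum>b<din. mtrace dout (Y * \<Phi> (?E a b)) * X $$ (a, b))" by (rule sum.swap)
  also have "\<dots> = (\<Sum>a<din. \<Sum>b<din. \<Sum>k<dout. \<Sum>l<dout. Y $$ (k, l) * (X $$ (a, b) * \<Phi> (?E a b) $$ (l, k)))"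
    unfolding mtrace_mult_sum[OF Y C[OF matrix_unit_carrier]]
    by (simp add: sum_distrib_left sum_distrib_right mult_ac)
  also have "\<dots> = (\<Sum>a<din. \<Sum>k<dout. \<Sum>b<din. \<Sum>l<dout. Y $$ (k, l) * (X $$ (a, b) * \<Phi> (?E a b) $$ (l, k)))"
    by (rule sum.cong[OF refl], rule sum.swap)
  also have "\<dots> = (\<Sum>k<dout. \<Sum>a<din. \<Sum>b<din. \<Sum>l<dout. Y $$ (k, l) * (X $$ (a, b) * \<Phi> (?E a b) $$ (l, k)))"
    by (rule sum.swap)
  also have "\<dots> = (\<Sum>k<dout. \<Sum>a<din. \<Sum>l<dout. \<Sum>b<din. Y $$ (k, l) * (X $$ (a, b) * \<Phi> (?E a b) $$ (l, k)))"
    by (rule sum.cong[OF refl], rule sum.cong[OF refl], rule sum.swap)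
  also have "\<dots> = (\<Sum>k<dout. \<Sum>l<dout. \<Sum>a<din. \<Sum>b<din. Y $$ (k, l) * (X $$ (a, b) * \<Phi> (?E a b) $$ (l, k)))"
    by (rule sum.cong[OF refl], rule sum.swap)
  also have "\<dots> = mtrace dout (Y * \<Phi> X)"
    unfolding mtrace_mult_sum[OF Y C[OF X]]
    by (intro sum.cong refl) (simp add: channel_entry[OF ch X] sum_distrib_left)
  finally show ?thesis by simp
qed

section \<open>Block matrices and the Schwarz inequality\<close>

definition bform :: "nat \<Rightarrow> complex mat \<Rightarrow> (nat \<Rightarrow> complex) \<Rightarrow> (nat \<Rightarrow> complex) \<Rightarrow> complex" where
  "bform d M u w = (\<Sum>i<d. \<Sum>j<d. cnj (u i) * M $$ (i, j) * w j)"

lemma qform_bform: "qform d M v = bform d M v v"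
  by (simp add: qform_def bform_def)

lemma bform_add:
  "bform d M (\<lambda>a. u a + u' a) w = bform d M u w + bform d M u' w"
  "bform d M u (\<lambda>a. w a + w' a) = bform d M u w + bform d M u w'"
  unfolding bform_def by (simp_all add: algebra_simps sum.distrib)

lemma bform_mult_right:
  assumes "M \<in> carrier_mat d d" "Z \<in> carrier_mat d d"
  shows "bform d (M * Z) u w = bform d M u (\<lambda>a. \<Sum>b<d. Z $$ (a, b) * w b)"
proof -
  have "bform d (M * Z) u w = (\<Sum>i<d. \<Sum>j<d. \<Sum>l<d. cnj (u i) * M $$ (i, l) * (Z $$ (l, j) * w j))"
    unfolding bform_def
    by (intro sum.cong refl) (simp add: index_mult_sum[OF assms] sum_distrib_left sum_distrib_right mult_ac)
  also have "\<dots> = (\<Sum>i<d. \<Sum>l<d. \<Sum>j<d. cnj (u i) * M $$ (i, l) * (Z $$ (l, j) * w j))"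
    by (rule sum.cong[OF refl], rule sum.swap)
  finally show ?thesis unfolding bform_def by (simp add: sum_distrib_left)
qed

lemma bform_mult_left:
  assumes "M \<in> carrier_mat d d" "Z \<in> carrier_mat d d"
  shows "bform d (dagger Z * M) u w = bform d M (\<lambda>a. \<Sum>b<d. Z $$ (a, b) * u b) w"
proof -
  have "bform d (dagger Z * M) u w = (\<Sum>i<d. \<Sum>j<d. \<Sum>l<d. cnj (Z $$ (l, i) * u i) * M $$ (l, j) * w j)"
    unfolding bform_def using assms
    by (intro sum.cong refl) (simp add: index_mult_sum[of _ d d _ d] sum_distrib_left sum_distrib_right mult_ac)
  also have "\<dots> = (\<Sum>i<d. \<Sum>l<d. \<Sum>j<d. cnj (Z $$ (l, i) * u i) * M $$ (l, j) * w j)"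
    by (rule sum.cong[OF refl], rule sum.swap)
  also have "\<dots> = (\<Sum>l<d. \<Sum>i<d. \<Sum>j<d. cnj (Z $$ (l, i) * u i) * M $$ (l, j) * w j)"
    by (rule sum.swap)
  also have "\<dots> = (\<Sum>l<d. \<Sum>j<d. \<Sum>i<d. cnj (Z $$ (l, i) * u i) * M $$ (l, j) * w j)"
    by (rule sum.cong[OF refl], rule sum.swap)
  finally show ?thesis unfolding bform_def by (simp add: sum_distrib_right)
qed

lemma qform_four_block:
  assumes "A \<in> carrier_mat d d" "B \<in> carrier_mat d d" "C \<in> carrier_mat d d" "D \<in> carrier_mat d d"
  shows "qform (2 * d) (four_block_mat A B C D) v =
    bform d A v v + bform d B v (\<lambda>i. v (d + i)) + bform d C (\<lambda>i. v (d + i)) v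
      + bform d D (\<lambda>i. v (d + i)) (\<lambda>i. v (d + i))"
proof -
  have S: "(\<Sum>i<2 * d. f i) = (\<Sum>i<d. f i) + (\<Sum>i<d. f (d + i))" for f :: "nat \<Rightarrow> complex"
    unfolding sum_product_index by (simp add: numeral_2_eq_2)
  show ?thesis unfolding qform_def bform_def S using assms by (simp add: sum.distrib)
qed

text \<open>The block matrix is T^dagger \<rho> T for the row T = (1 Z): its form at (v, w) is that
  of \<rho> at v + Z w.\<close>

lemma psd_schwarz_block:
  assumes "psd d \<rho>" "Z \<in> carrier_mat d d"
  shows "psd (2 * d) (four_block_mat \<rho> (\<rho> * Z) (dagger Z * \<rho>) (dagger Z * \<rho> * Z))"
proof -
  note \<rho> = psdD[OF assms(1)] and Z = assms(2)
  have "qform (2 * d) (four_block_mat \<rho> (\<rho> * Z) (dagger Z * \<rho>) (dagger Z * \<rho> * Z)) v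
     = qform d \<rho> (\<lambda>a. v a + (\<Sum>b<d. Z $$ (a, b) * v (d + b)))" for v
    using \<rho>(1) Z
    by (subst qform_four_block) (simp_all add: bform_mult_right[OF _ Z] bform_mult_left[OF _ Z] qform_bform bform_add)
  then show ?thesis using \<rho> Z four_block_carrier_mat[of \<rho> d d "dagger Z * \<rho> * Z" d d]
    by (simp add: psd_iff mult_2)
qed

lemma psd_one: "psd d (1\<^sub>m d)"
proof -
  have "qform d (1\<^sub>m d) v = (\<Sum>i<d. of_real ((cmod (v i))\<^sup>2))" for v
    unfolding qform_def complex_norm_square
    by (intro sum.cong refl)
       (simp add: if_distrib[of "\<lambda>x. _ * x"] if_distrib[of "\<lambda>x. x * _"] sum.delta mult.commute cong: if_cong)
  then show ?thesis by (auto simp: psd_iff Re_sum Im_sum intro!: sum_nonneg)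
qed

text \<open>The ancilla is the leading index, so its two values are the two block rows and the
  extension by a qubit acts block by block.\<close>

lemma id_tensor_two_block:
  assumes ch: "channel din dout \<Phi>"
    and "A \<in> carrier_mat din din" "B \<in> carrier_mat din din" "C \<in> carrier_mat din din" "D \<in> carrier_mat din din"
  shows "id_tensor 2 din dout \<Phi> (four_block_mat A B C D) = four_block_mat (\<Phi> A) (\<Phi> B) (\<Phi> C) (\<Phi> D)"
proof -
  let ?F = "four_block_mat A B C D"
  have blks: "blk din ?F 0 0 = A" "blk din ?F 0 (Suc 0) = B" "blk din ?F (Suc 0) 0 = C" "blk din ?F (Suc 0) (Suc 0) = D"
    using assms(2-) by (auto simp: blk_def intro!: eq_matI)
  note C = channelD(1)[OF ch]
  show ?thesis
  proof (rule eq_matI)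
    fix i j assume "i < dim_row (four_block_mat (\<Phi> A) (\<Phi> B) (\<Phi> C) (\<Phi> D))"
      "j < dim_col (four_block_mat (\<Phi> A) (\<Phi> B) (\<Phi> C) (\<Phi> D))"
    then have ij: "i < 2 * dout" "j < 2 * dout" using C[OF assms(2)] C[OF assms(5)] by auto
    have dm: "n div dout = (if n < dout then 0 else Suc 0) \<and> n mod dout = (if n < dout then n else n - dout)"
      if "n < 2 * dout" for n
      using that by (auto simp: div_if mod_if)
    show "id_tensor 2 din dout \<Phi> ?F $$ (i, j) = four_block_mat (\<Phi> A) (\<Phi> B) (\<Phi> C) (\<Phi> D) $$ (i, j)"
      using ij dm[OF ij(1)] dm[OF ij(2)] C[OF assms(2)] C[OF assms(3)] C[OF assms(4)] C[OF assms(5)]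
      by (auto simp: id_tensor_def blks)
  qed (use C[OF assms(2)] C[OF assms(5)] in \<open>auto simp: id_tensor_def\<close>)
qed

lemma channel_schwarz_block:
  assumes ch: "channel din dout \<Phi>" and \<rho>: "psd din \<rho>" and Z: "Z \<in> carrier_mat din din"
  shows "psd (2 * dout) (four_block_mat (\<Phi> \<rho>) (\<Phi> (\<rho> * Z)) (\<Phi> (dagger Z * \<rho>)) (\<Phi> (dagger Z * \<rho> * Z)))"
  using channelD(4)[OF ch psd_schwarz_block[OF \<rho> Z]] psdD(1)[OF \<rho>] Z
  by (simp add: id_tensor_two_block[OF ch])

text \<open>The image of the Schwarz block matrix is positive, hence Hermitian, so its off-diagonal
  blocks are adjoint to each other. With \<rho> = 1 this says that channels commute with
  \<open>dagger\<close>.\<close>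

lemma channel_dagger_mult:
  assumes ch: "channel din dout \<Phi>" and \<rho>: "psd din \<rho>" and Z: "Z \<in> carrier_mat din din"
  shows "dagger (\<Phi> (\<rho> * Z)) = \<Phi> (dagger Z * \<rho>)"
proof -
  let ?F = "four_block_mat (\<Phi> \<rho>) (\<Phi> (\<rho> * Z)) (\<Phi> (dagger Z * \<rho>)) (\<Phi> (dagger Z * \<rho> * Z))"
  note C = channelD(1)[OF ch]
  have c: "\<Phi> \<rho> \<in> carrier_mat dout dout" "\<Phi> (\<rho> * Z) \<in> carrier_mat dout dout"
    "\<Phi> (dagger Z * \<rho>) \<in> carrier_mat dout dout" "\<Phi> (dagger Z * \<rho> * Z) \<in> carrier_mat dout dout"
    using psdD(1)[OF \<rho>] Z by (auto intro!: C)
  have H: "dagger ?F = ?F" by (rule psd_hermitian[OF channel_schwarz_block[OF ch \<rho> Z]])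
  show ?thesis
  proof (rule eq_matI)
    fix i j assume "i < dim_row (\<Phi> (dagger Z * \<rho>))" "j < dim_col (\<Phi> (dagger Z * \<rho>))"
    then have ij: "i < dout" "j < dout" using c by auto
    have "dagger ?F $$ (dout + i, j) = ?F $$ (dout + i, j)" using H by simp
    then show "dagger (\<Phi> (\<rho> * Z)) $$ (i, j) = \<Phi> (dagger Z * \<rho>) $$ (i, j)"
      using ij c by simp
  qed (use c in auto)
qed

lemma channel_dagger:
  assumes "channel din dout \<Phi>" "X \<in> carrier_mat din din"
  shows "\<Phi> (dagger X) = dagger (\<Phi> X)"
  using channel_dagger_mult[OF assms(1) psd_one assms(2)] assms(2) by (simp add: right_mult_one_mat[of _ din din])

lemma adjoint_map_dagger:
  assumes ch: "channel din dout \<Phi>" and Y: "Y \<in> carrier_mat dout dout"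
  shows "adjoint_map din dout \<Phi> (dagger Y) = dagger (adjoint_map din dout \<Phi> Y)"
proof (rule eq_matI)
  fix i j assume "i < dim_row (dagger (adjoint_map din dout \<Phi> Y))" "j < dim_col (dagger (adjoint_map din dout \<Phi> Y))"
  then have ij: "i < din" "j < din" by (auto simp: adjoint_map_def)
  let ?E = "matrix_unit din"
  have E: "?E j i = dagger (?E i j)" by (rule eq_matI) (auto simp: matrix_unit_def)
  have c: "\<Phi> (?E i j) \<in> carrier_mat dout dout" using channelD(1)[OF ch] by auto
  have "mtrace dout (dagger Y * \<Phi> (?E j i)) = mtrace dout (dagger (\<Phi> (?E i j) * Y))"
    unfolding E channel_dagger[OF ch matrix_unit_carrier] dagger_mult[OF c Y] ..
  also have "\<dots> = cnj (mtrace dout (Y * \<Phi> (?E i j)))"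
    using c Y by (simp add: mtrace_dagger mtrace_mult_commute[OF c Y])
  finally show "adjoint_map din dout \<Phi> (dagger Y) $$ (i, j) = dagger (adjoint_map din dout \<Phi> Y) $$ (i, j)"
    using ij by (simp add: adjoint_map_def)
qed (auto simp: adjoint_map_def)

text \<open>This is adj(Y) adj(Y)^dagger \<le> adj(Y Y^dagger) paired with \<rho>, where adj is the
  adjoint map. Testing the image of the Schwarz block matrix against suitable vectors shows that
  Tr(\<Phi>(\<rho>) Y Y^dagger) - cnj s - s + s has nonnegative real part, with s = Tr(\<rho> Z
  Z^dagger).\<close>

lemma kadison_schwarz:
  assumes ch: "channel din dout \<Phi>" and \<rho>: "psd din \<rho>" and Y: "Y \<in> carrier_mat dout dout"
  defines "Z \<equiv> adjoint_map din dout \<Phi> Y"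
  shows "Re (mtrace din (\<rho> * (Z * dagger Z))) \<le> Re (mtrace dout (\<Phi> \<rho> * (Y * dagger Y)))"
proof -
  note C = channelD(1)[OF ch]
  have Z: "Z \<in> carrier_mat din din" "dagger Z \<in> carrier_mat din din" unfolding Z_def by auto
  note \<rho>c = psdD(1)[OF \<rho>]
  define A B D E where "A = \<Phi> \<rho>" and "B = \<Phi> (\<rho> * Z)" and "D = \<Phi> (dagger Z * \<rho>)" and "E = \<Phi> (dagger Z * \<rho> * Z)"
  have c: "A \<in> carrier_mat dout dout" "B \<in> carrier_mat dout dout" "D \<in> carrier_mat dout dout" "E \<in> carrier_mat dout dout"
    unfolding A_def B_def D_def E_def using \<rho>c Z by (auto intro!: C)
  have P: "psd (2 * dout) (four_block_mat A B D E)"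
    unfolding A_def B_def D_def E_def by (rule channel_schwarz_block[OF ch \<rho> Z(1)])
  \<comment> \<open>The k-th column of \<open>Y\<close> stacked on minus the k-th basis vector;
    summing over k turns the four blocks into traces.\<close>
  define v where "v k a = (if a < dout then Y $$ (a, k) else if a = dout + k then - 1 else 0)" for k a
  have "0 \<le> Re (\<Sum>k<dout. qform (2 * dout) (four_block_mat A B D E) (v k))"
    unfolding Re_sum by (intro sum_nonneg psdD(3)[OF P])
  also have "(\<Sum>k<dout. qform (2 * dout) (four_block_mat A B D E) (v k))
     = mtrace dout (A * (Y * dagger Y)) - mtrace dout (dagger Y * B) - mtrace dout (D * Y) + mtrace dout E"
  proof -
    have b1: "bform dout A (v k) (v k) = (dagger Y * A * Y) $$ (k, k)" if "k < dout" for k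
      unfolding conj_diag_qform[OF c(1) Y that] qform_def bform_def
      by (intro sum.cong refl) (simp add: v_def)
    have b2: "bform dout B (v k) (\<lambda>i. v k (dout + i)) = - (dagger Y * B) $$ (k, k)" if "k < dout" for k
      unfolding bform_def using that Y c
      by (simp add: index_mult_sum[of _ dout dout _ dout] v_def sum_negf if_distrib[of "\<lambda>x. _ * x"] sum.delta cong: if_cong)
    have b3: "bform dout D (\<lambda>i. v k (dout + i)) (v k) = - (D * Y) $$ (k, k)" if "k < dout" for k
      unfolding bform_def using that Y c
      by (subst sum.swap) (simp add: index_mult_sum[of _ dout dout _ dout] v_def sum_negf
          if_distrib[of "\<lambda>x. x * _"] if_distrib[of cnj] sum.delta cong: if_cong)
    have b4: "bform dout E (\<lambda>i. v k (dout + i)) (\<lambda>i. v k (dout + i)) = E $$ (k, k)" if "k < dout" for k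
      unfolding bform_def using that
      by (simp add: v_def if_distrib[of "\<lambda>x. x * _"] if_distrib[of "\<lambda>x. _ * x"] if_distrib[of cnj] sum_negf sum.delta cong: if_cong)
    have "mtrace dout (dagger Y * A * Y) = mtrace dout (A * (Y * dagger Y))"
      using mtrace_mult_commute[of "dagger Y" dout "A * Y"] Y c by (simp add: assoc_mult_mat[of _ dout dout _ dout _ dout])
    then show ?thesis
      unfolding qform_four_block[OF c] by (simp add: b1 b2 b3 b4 mtrace_def sum.distrib sum_subtractf)
  qed
  also have "mtrace dout (D * Y) = mtrace din (\<rho> * (Z * dagger Z))"
  proof -
    have "mtrace dout (D * Y) = mtrace dout (Y * D)" by (rule mtrace_mult_commute[OF c(3) Y])
    also have "\<dots> = mtrace din (Z * (dagger Z * \<rho>))"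
      unfolding D_def Z_def using \<rho>c Z by (intro mtrace_adjoint_map[OF ch _ Y]) auto
    also have "\<dots> = mtrace din ((Z * dagger Z) * \<rho>)" using \<rho>c Z by (simp add: assoc_mult_mat[of _ din din _ din _ din])
    also have "\<dots> = mtrace din (\<rho> * (Z * dagger Z))" using \<rho>c Z by (intro mtrace_mult_commute) auto
    finally show ?thesis .
  qed
  also have "mtrace dout (dagger Y * B) = cnj (mtrace din (\<rho> * (Z * dagger Z)))"
  proof -
    have "D = dagger B" unfolding B_def D_def using channel_dagger_mult[OF ch \<rho> Z(1)] by simp
    then have "dagger (dagger Y * B) = D * Y" using Y c by (simp add: dagger_mult[of _ dout dout _ dout])
    then have "cnj (mtrace dout (dagger Y * B)) = mtrace din (\<rho> * (Z * dagger Z))"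
      using calculation \<open>mtrace dout (D * Y) = _\<close> mtrace_dagger[of "dagger Y * B" dout] Y c by simp
    then show ?thesis by (metis complex_cnj_cnj)
  qed
  also have "mtrace dout E = mtrace din (\<rho> * (Z * dagger Z))"
  proof -
    have "mtrace dout E = mtrace din (dagger Z * (\<rho> * Z))"
      unfolding E_def using \<rho>c Z by (subst channelD(3)[OF ch]) (auto simp: assoc_mult_mat[of _ din din _ din _ din])
    also have "\<dots> = mtrace din ((\<rho> * Z) * dagger Z)" using \<rho>c Z by (intro mtrace_mult_commute) auto
    finally show ?thesis using \<rho>c Z by (simp add: assoc_mult_mat[of _ din din _ din _ din])
  qed
  finally show ?thesis by (simp add: A_def)
qed

text \<open>The adjoint pairing preserves the linear term exactly. The two quadratic terms enter
  with a minus sign, and the Schwarz inequality, used for \<sigma> with \<open>Y\<close> and for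
  \<rho> with \<open>dagger Y\<close>, says that they do not grow when \<open>Y\<close> is pulled
  back.\<close>

theorem varf_channel_le:
  assumes ch: "channel din dout \<Phi>" and \<rho>: "psd din \<rho>" and \<sigma>: "psd din \<sigma>"
    and Y: "Y \<in> carrier_mat dout dout" and t: "0 < t"
  shows "varf dout t Y (\<Phi> \<rho>) (\<Phi> \<sigma>) \<le> varf din t (adjoint_map din dout \<Phi> Y) \<rho> \<sigma>"
proof -
  have "mtrace dout (dagger Y * \<Phi> \<rho>) = mtrace din (dagger (adjoint_map din dout \<Phi> Y) * \<rho>)"
    using mtrace_adjoint_map[OF ch psdD(1)[OF \<rho>] dagger_carrier[OF Y]] adjoint_map_dagger[OF ch Y] by simp
  moreover note kadison_schwarz[OF ch \<sigma> Y]
  moreover have "Re (mtrace din (\<rho> * (dagger (adjoint_map din dout \<Phi> Y) * adjoint_map din dout \<Phi> Y)))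
      \<le> Re (mtrace dout (\<Phi> \<rho> * (dagger Y * Y)))"
    using kadison_schwarz[OF ch \<rho> dagger_carrier[OF Y]] adjoint_map_dagger[OF ch Y] by simp
  ultimately show ?thesis unfolding varf_def using t by (simp add: mult_left_mono diff_mono)
qed

lemma channel_psd:
  assumes ch: "channel din dout \<Phi>" and \<rho>: "psd din \<rho>"
  shows "psd dout (\<Phi> \<rho>)"
proof -
  have "id_tensor 1 din dout \<Phi> \<rho> = \<Phi> \<rho>"
  proof -
    have "blk din \<rho> 0 0 = \<rho>" using psdD(1)[OF \<rho>] by (intro eq_matI) (auto simp: blk_def)
    then show ?thesis using channelD(1)[OF ch psdD(1)[OF \<rho>]]
      by (intro eq_matI) (auto simp: id_tensor_def)
  qed
  then show ?thesis using channelD(4)[OF ch, of 1 \<rho>] \<rho> by simp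
qed

section \<open>Data processing and Fano bound\<close>

lemma product_index_less:
  assumes "r < k" "a < (d::nat)" shows "r * d + a < k * d"
proof -
  have "r * d + a < Suc r * d" using assms(2) by simp
  also have "\<dots> \<le> k * d" using assms(1) by (intro mult_le_mono1) simp
  finally show ?thesis .
qed

lemma product_index_div_mod:
  assumes "i < k * (d::nat)" shows "i div d < k" "i mod d < d"
  using assms by (auto simp: less_mult_imp_div_less intro!: mod_less_divisor gr0I)

lemma blk_carrier [simp, intro]: "blk d X r s \<in> carrier_mat d d"
  by (simp add: blk_def)

lemma id_tensor_carrier [simp, intro]: "id_tensor k din dout \<Phi> X \<in> carrier_mat (k * dout) (k * dout)"
  by (simp add: id_tensor_def)

lemma id_tensor_entry:
  assumes "r < k" "s < k" "a < dout" "b < dout"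
  shows "id_tensor k din dout \<Phi> X $$ (r * dout + a, s * dout + b) = \<Phi> (blk din X r s) $$ (a, b)"
  using assms by (simp add: id_tensor_def product_index_less)

text \<open>Mixed-radix indices make the tensor product strictly associative: an ancilla of
  dimension k' on top of one of dimension k is a single ancilla of dimension k' k. Complete
  positivity of extended channels follows from this.\<close>

lemma id_tensor_id_tensor:
  "id_tensor k' (k * din) (k * dout) (id_tensor k din dout \<Phi>) X = id_tensor (k' * k) din dout \<Phi> X"
proof (rule eq_matI)
  fix i j assume "i < dim_row (id_tensor (k' * k) din dout \<Phi> X)" "j < dim_col (id_tensor (k' * k) din dout \<Phi> X)"
  then have ij: "i < k' * (k * dout)" "j < k' * (k * dout)" by (simp_all add: id_tensor_def mult.assoc)
  note im = product_index_div_mod[OF ij(1)] and jm = product_index_div_mod[OF ij(2)]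
  note im' = product_index_div_mod[OF im(2)] and jm' = product_index_div_mod[OF jm(2)]
  have dd: "n div dout = n div (k * dout) * k + n mod (k * dout) div dout" "n mod (k * dout) mod dout = n mod dout" for n
  proof -
    have "n = n div (k * dout) * (k * dout) + n mod (k * dout)"
      by (rule div_mult_mod_eq[symmetric])
    then have "n = dout * (n div (k * dout) * k) + n mod (k * dout)" by (simp add: mult_ac)
    then have "n div dout = (dout * (n div (k * dout) * k) + n mod (k * dout)) div dout" by simp
    then show "n div dout = n div (k * dout) * k + n mod (k * dout) div dout"
      using im'(2) by (simp add: div_mult_self4 del: mult_div_mod_eq div_mult_mod_eq)
    show "n mod (k * dout) mod dout = n mod dout" by (simp add: mod_mod_cancel)
  qed
  have "blk din (blk (k * din) X (i div (k * dout)) (j div (k * dout))) (i mod (k * dout) div dout) (j mod (k * dout) div dout)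
     = blk din X (i div dout) (j div dout)"
    unfolding dd(1)[of i] dd(1)[of j] using im'(1) jm'(1)
    by (intro eq_matI) (auto simp: blk_def product_index_less add_mult_distrib add.assoc mult.assoc)
  then show "id_tensor k' (k * din) (k * dout) (id_tensor k din dout \<Phi>) X $$ (i, j) = id_tensor (k' * k) din dout \<Phi> X $$ (i, j)"
    using ij im jm by (simp add: id_tensor_def[of k'] id_tensor_def[of "k' * k"] id_tensor_def[of k] mult.assoc dd(2))
qed (auto simp: id_tensor_def mult.assoc)

lemma channel_id_tensor:
  assumes ch: "channel din dout \<Phi>"
  shows "channel (k * din) (k * dout) (id_tensor k din dout \<Phi>)"
  unfolding channel_def
proof (intro conjI ballI allI impI)
  note C = channelD(1)[OF ch]
  fix X Y :: "complex mat" and c :: complex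
  assume X: "X \<in> carrier_mat (k * din) (k * din)" and Y: "Y \<in> carrier_mat (k * din) (k * din)"
  show "id_tensor k din dout \<Phi> (c \<cdot>\<^sub>m X + Y) = c \<cdot>\<^sub>m id_tensor k din dout \<Phi> X + id_tensor k din dout \<Phi> Y"
  proof (rule eq_matI)
    fix i j assume "i < dim_row (c \<cdot>\<^sub>m id_tensor k din dout \<Phi> X + id_tensor k din dout \<Phi> Y)"
      "j < dim_col (c \<cdot>\<^sub>m id_tensor k din dout \<Phi> X + id_tensor k din dout \<Phi> Y)"
    then have ij: "i < k * dout" "j < k * dout" by (auto simp: id_tensor_def)
    note im = product_index_div_mod[OF ij(1)] and jm = product_index_div_mod[OF ij(2)]
    have "blk din (c \<cdot>\<^sub>m X + Y) (i div dout) (j div dout)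
        = c \<cdot>\<^sub>m blk din X (i div dout) (j div dout) + blk din Y (i div dout) (j div dout)"
      using X Y im jm by (intro eq_matI) (auto simp: blk_def product_index_less)
    then show "id_tensor k din dout \<Phi> (c \<cdot>\<^sub>m X + Y) $$ (i, j) = (c \<cdot>\<^sub>m id_tensor k din dout \<Phi> X + id_tensor k din dout \<Phi> Y) $$ (i, j)"
      using ij im jm C[OF blk_carrier, of X "i div dout" "j div dout"] C[OF blk_carrier, of Y "i div dout" "j div dout"]
      by (simp add: id_tensor_def channelD(2)[OF ch])
  qed (auto simp: id_tensor_def)
next
  fix X :: "complex mat" assume X: "X \<in> carrier_mat (k * din) (k * din)"
  have "mtrace (k * dout) (id_tensor k din dout \<Phi> X) = (\<Sum>r<k. mtrace dout (\<Phi> (blk din X r r)))"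
    unfolding mtrace_def sum_product_index by (intro sum.cong refl) (simp add: id_tensor_entry)
  also have "\<dots> = (\<Sum>r<k. mtrace din (blk din X r r))"
    by (simp add: channelD(3)[OF ch])
  also have "\<dots> = mtrace (k * din) X"
    unfolding mtrace_def sum_product_index by (intro sum.cong refl) (simp add: blk_def)
  finally show "mtrace (k * dout) (id_tensor k din dout \<Phi> X) = mtrace (k * din) X" .
next
  fix k' X assume "psd (k' * (k * din)) X"
  then show "psd (k' * (k * dout)) (id_tensor k' (k * din) (k * dout) (id_tensor k din dout \<Phi>) X)"
    unfolding id_tensor_id_tensor using channelD(4)[OF ch, of "k' * k" X] by (simp add: mult.assoc)
qed auto

section \<open>Uniform mixtures over a finite index set\<close>

definition mavg :: "nat \<Rightarrow> 'a set \<Rightarrow> ('a \<Rightarrow> complex mat) \<Rightarrow> complex mat" where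
  "mavg d I X = mat d d (\<lambda>ij. (\<Sum>m\<in>I. X m $$ ij) / of_nat (card I))"

lemma mavg_carrier [simp, intro]: "mavg d I X \<in> carrier_mat d d"
  by (simp add: mavg_def)

lemma mavg_cong: "(\<And>m. m \<in> I \<Longrightarrow> X m = Y m) \<Longrightarrow> mavg d I X = mavg d I Y"
  by (auto simp: mavg_def intro!: eq_matI)

lemma channel_mavg:
  assumes ch: "channel din dout \<Phi>" and X: "\<And>m. m \<in> I \<Longrightarrow> X m \<in> carrier_mat din din"
  shows "\<Phi> (mavg din I X) = mavg dout I (\<lambda>m. \<Phi> (X m))"
proof (rule eq_matI)
  fix k l assume "k < dim_row (mavg dout I (\<lambda>m. \<Phi> (X m)))" "l < dim_col (mavg dout I (\<lambda>m. \<Phi> (X m)))"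
  then have kl: "k < dout" "l < dout" by (auto simp: mavg_def)
  let ?e = "\<lambda>a b. \<Phi> (matrix_unit din a b) $$ (k, l)"
  have "\<Phi> (mavg din I X) $$ (k, l) = (\<Sum>a<din. \<Sum>b<din. (\<Sum>m\<in>I. X m $$ (a, b) * ?e a b / of_nat (card I)))"
    unfolding channel_entry[OF ch mavg_carrier kl]
    by (intro sum.cong refl) (simp add: mavg_def sum_distrib_right sum_divide_distrib)
  also have "\<dots> = (\<Sum>a<din. \<Sum>m\<in>I. \<Sum>b<din. X m $$ (a, b) * ?e a b / of_nat (card I))"
    by (rule sum.cong[OF refl], rule sum.swap)
  also have "\<dots> = (\<Sum>m\<in>I. \<Sum>a<din. \<Sum>b<din. X m $$ (a, b) * ?e a b / of_nat (card I))"
    by (rule sum.swap)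
  also have "\<dots> = (\<Sum>m\<in>I. \<Phi> (X m) $$ (k, l)) / of_nat (card I)"
    unfolding sum_divide_distrib
    by (intro sum.cong refl) (simp add: channel_entry[OF ch X kl] sum_divide_distrib)
  finally show "\<Phi> (mavg din I X) $$ (k, l) = mavg dout I (\<lambda>m. \<Phi> (X m)) $$ (k, l)"
    using kl by (simp add: mavg_def)
qed (use channelD(1)[OF ch mavg_carrier] in \<open>auto simp: mavg_def\<close>)

lemma qform_mavg: "qform d (mavg d I X) v = (\<Sum>m\<in>I. qform d (X m) v) / of_nat (card I)"
proof -
  let ?t = "\<lambda>m i j. cnj (v i) * X m $$ (i, j) * v j / of_nat (card I)"
  have "qform d (mavg d I X) v = (\<Sum>i<d. \<Sum>j<d. \<Sum>m\<in>I. ?t m i j)"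
    unfolding qform_def
    by (intro sum.cong refl) (simp add: mavg_def sum_distrib_left sum_distrib_right sum_divide_distrib)
  also have "\<dots> = (\<Sum>i<d. \<Sum>m\<in>I. \<Sum>j<d. ?t m i j)"
    by (rule sum.cong[OF refl], rule sum.swap)
  also have "\<dots> = (\<Sum>m\<in>I. \<Sum>i<d. \<Sum>j<d. ?t m i j)"
    by (rule sum.swap)
  finally show ?thesis unfolding qform_def by (simp add: sum_divide_distrib)
qed

lemma psd_mavg:
  assumes "\<And>m. m \<in> I \<Longrightarrow> psd d (X m)"
  shows "psd d (mavg d I X)"
proof -
  have "qform d (mavg d I X) v = of_real ((\<Sum>m\<in>I. Re (qform d (X m) v)) / of_nat (card I))" for v
  proof -
    have "(\<Sum>m\<in>I. qform d (X m) v) = (\<Sum>m\<in>I. of_real (Re (qform d (X m) v)))"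
      by (rule sum.cong[OF refl]) (use psdD(2)[OF assms] in \<open>simp add: complex_eq_iff\<close>)
    then show ?thesis unfolding qform_mavg by simp
  qed
  moreover have "0 \<le> (\<Sum>m\<in>I. Re (qform d (X m) v)) / of_nat (card I)" for v
    using psdD(3)[OF assms] by (intro divide_nonneg_nonneg sum_nonneg) auto
  ultimately show ?thesis unfolding psd_iff by (simp del: of_real_divide)
qed

lemma mtrace_mavg: "mtrace d (mavg d I X) = (\<Sum>m\<in>I. mtrace d (X m)) / of_nat (card I)"
proof -
  have "mtrace d (mavg d I X) = (\<Sum>i<d. \<Sum>m\<in>I. X m $$ (i, i) / of_nat (card I))"
    unfolding mtrace_def by (intro sum.cong refl) (simp add: mavg_def sum_divide_distrib)
  also have "\<dots> = (\<Sum>m\<in>I. \<Sum>i<d. X m $$ (i, i) / of_nat (card I))" by (rule sum.swap)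
  finally show ?thesis by (simp add: mtrace_def sum_divide_distrib)
qed

text \<open>Domination \<rho> \<le> c \<sigma>; for positive matrices in finite dimension it amounts
  to inclusion of supports. In this form it is immediate for a member of a uniform mixture, with the
  number of members as constant.\<close>

definition abs_cont :: "nat \<Rightarrow> complex mat \<Rightarrow> complex mat \<Rightarrow> bool" where
  "abs_cont d \<rho> \<sigma> \<longleftrightarrow> (\<exists>c. \<forall>v. Re (qform d \<rho> v) \<le> c * Re (qform d \<sigma> v))"

lemma abs_cont_mavg:
  assumes "finite I" "m \<in> I" "\<And>m. m \<in> I \<Longrightarrow> psd d (X m)"
  shows "abs_cont d (X m) (mavg d I X)"
  unfolding abs_cont_def
proof (intro exI allI)
  fix v
  have c: "0 < card I" using assms by (auto simp: card_gt_0_iff)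
  have "Re (qform d (X m) v) \<le> (\<Sum>m\<in>I. Re (qform d (X m) v))"
    using assms psdD(3) by (intro member_le_sum) auto
  also have "\<dots> = real (card I) * Re (qform d (mavg d I X) v)"
    using c by (simp add: qform_mavg Re_divide_of_nat Re_sum)
  finally show "Re (qform d (X m) v) \<le> real (card I) * Re (qform d (mavg d I X) v)" .
qed

text \<open>Relative entropy in nats. The formula is meaningful only under abs_cont, where ln 0 = 0
  only occurs with coefficient 0.\<close>
definition relent :: "nat \<Rightarrow> complex mat \<Rightarrow> complex mat \<Rightarrow> real" where
  "relent d \<rho> \<sigma> = (\<Sum>(i, j)\<in>{..<d} \<times> {..<d}.
     overlap d \<rho> \<sigma> i j * (eigval d \<rho> i * (ln (eigval d \<rho> i) - ln (eigval d \<sigma> j))))"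

lemma unitary_dagger: "unitary d U \<Longrightarrow> unitary d (dagger U)"
  unfolding unitary_def[of d "dagger U"] by (simp add: unitaryD)

text \<open>In the eigenbasis of \<sigma> the matrix \<rho> is diagonalised by the product of the
  two eigenvector matrices, whose squared moduli are the overlaps. For a state these are the outcome
  probabilities of measuring \<rho> in that basis.\<close>

lemma qform_eigvec:
  assumes \<rho>: "psd d \<rho>" and \<sigma>: "psd d \<sigma>" and j: "j < d"
  shows "Re (qform d \<rho> (\<lambda>a. eigvec d \<sigma> $$ (a, j))) = (\<Sum>i<d. overlap d \<rho> \<sigma> i j * eigval d \<rho> i)"
proof -
  note S\<rho> = spectralD[OF psd_spectral[OF \<rho>]] and S\<sigma> = spectralD[OF psd_spectral[OF \<sigma>]]
  let ?U = "eigvec d \<rho>" and ?V = "eigvec d \<sigma>"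
  have "dagger ?V * \<rho> * ?V = dagger ?V * (?U * diagm d (eigval d \<rho>) * dagger ?U) * ?V"
    by (rule arg_cong[OF S\<rho>(4)])
  also have "\<dots> = (dagger ?V * ?U) * diagm d (eigval d \<rho>) * dagger (dagger ?V * ?U)"
    using S\<rho>(2) S\<sigma>(2) by (simp add: dagger_mult[of _ d d _ d] assoc_mult_mat[of _ d d _ d _ d])
  finally have "spectral d (dagger ?V * \<rho> * ?V) (dagger ?V * ?U) (eigval d \<rho>)"
    unfolding spectral_def using unitary_mult[OF unitary_dagger[OF S\<sigma>(1)] S\<rho>(1)] by simp
  from spectral_entry[OF this j j]
  have "qform d \<rho> (\<lambda>a. ?V $$ (a, j)) = (\<Sum>i<d. of_real (overlap d \<rho> \<sigma> i j * eigval d \<rho> i))"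
    unfolding conj_diag_qform[OF S\<rho>(3) S\<sigma>(2) j] overlap_def of_real_mult complex_norm_square
    by (simp add: mult.commute)
  then show ?thesis by (simp add: Re_sum)
qed

lemma qform_eigvec_self:
  assumes \<sigma>: "psd d \<sigma>" and j: "j < d"
  shows "Re (qform d \<sigma> (\<lambda>a. eigvec d \<sigma> $$ (a, j))) = eigval d \<sigma> j"
proof -
  note S = spectralD[OF psd_spectral[OF \<sigma>]]
  show ?thesis using conj_diag_qform[OF S(3,2) j] S(5) j by (simp add: diagm_def flip: conj_diag_qform[OF S(3,2) j])
qed

lemma overlap_nonneg [simp]: "0 \<le> overlap d \<rho> \<sigma> i j"
  by (simp add: overlap_def)

lemma sum_overlap:
  assumes \<rho>: "psd d \<rho>" and \<sigma>: "psd d \<sigma>" and i: "i < d"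
  shows "(\<Sum>j<d. overlap d \<rho> \<sigma> i j) = 1"
proof -
  note S\<rho> = spectralD[OF psd_spectral[OF \<rho>]] and S\<sigma> = spectralD[OF psd_spectral[OF \<sigma>]]
  have "(\<Sum>j<d. complex_of_real (overlap d \<rho> \<sigma> i j)) = 1"
    using unitary_col_sum[OF unitary_mult[OF unitary_dagger[OF S\<sigma>(1)] S\<rho>(1)] i i]
    unfolding overlap_def complex_norm_square by (simp add: mult.commute)
  then show ?thesis by (simp flip: of_real_sum)
qed

lemma sum_eigval:
  assumes "psd d \<rho>" shows "(\<Sum>i<d. eigval d \<rho> i) = Re (mtrace d \<rho>)"
proof -
  note S = spectralD[OF psd_spectral[OF assms]]
  have "mtrace d \<rho> = mtrace d (diagm d (eigval d \<rho>))"
    using mtrace_unitary_conj[OF S(1) diagm_carrier] S(4) by metis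
  then show ?thesis by (simp add: mtrace_def diagm_def Re_sum)
qed

text \<open>Evaluating the domination at the j-th eigenvector of \<sigma> bounds the single term
  overlap times p_i by c q_j, which rules out q_j = 0.\<close>

lemma overlap_support:
  assumes \<rho>: "psd d \<rho>" and \<sigma>: "psd d \<sigma>" and ac: "abs_cont d \<rho> \<sigma>" and ij: "i < d" "j < d"
    and pos: "0 < overlap d \<rho> \<sigma> i j" "0 < eigval d \<rho> i"
  shows "0 < eigval d \<sigma> j"
proof -
  from ac obtain c where c: "\<And>v. Re (qform d \<rho> v) \<le> c * Re (qform d \<sigma> v)" by (auto simp: abs_cont_def)
  have "0 < overlap d \<rho> \<sigma> i j * eigval d \<rho> i" using pos by simp
  also have "\<dots> \<le> (\<Sum>i<d. overlap d \<rho> \<sigma> i j * eigval d \<rho> i)"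
    using ij psd_eigval_nonneg[OF \<rho>] by (intro member_le_sum) auto
  also have "\<dots> \<le> c * eigval d \<sigma> j"
    using c[of "\<lambda>a. eigvec d \<sigma> $$ (a, j)"] qform_eigvec[OF \<rho> \<sigma> ij(2)] qform_eigvec_self[OF \<sigma> ij(2)] by simp
  finally show ?thesis using psd_eigval_nonneg[OF \<sigma> ij(2)] by (cases "eigval d \<sigma> j = 0") auto
qed

lemma sum_overlap_eigval:
  assumes "psd d \<rho>" "psd d \<sigma>"
  shows "(\<Sum>(i, j)\<in>{..<d} \<times> {..<d}. overlap d \<rho> \<sigma> i j * eigval d \<rho> i) = Re (mtrace d \<rho>)"
  unfolding sum.cartesian_product[symmetric]
  using assms by (simp add: sum_distrib_right[symmetric] sum_overlap sum_eigval)

theorem relent_channel_le: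
  assumes ch: "channel din dout \<Phi>" and \<rho>: "psd din \<rho>" and \<sigma>: "psd din \<sigma>"
    and ac: "abs_cont din \<rho> \<sigma>" "abs_cont dout (\<Phi> \<rho>) (\<Phi> \<sigma>)"
  shows "relent dout (\<Phi> \<rho>) (\<Phi> \<sigma>) \<le> relent din \<rho> \<sigma>"
proof -
  note \<rho>' = channel_psd[OF ch \<rho>] and \<sigma>' = channel_psd[OF ch \<sigma>]
  have le: "varmax dout t (\<Phi> \<rho>) (\<Phi> \<sigma>) \<le> varmax din t \<rho> \<sigma>" if t: "0 < t" for t
  proof -
    obtain Y where Y: "Y \<in> carrier_mat dout dout" "varf dout t Y (\<Phi> \<rho>) (\<Phi> \<sigma>) = varmax dout t (\<Phi> \<rho>) (\<Phi> \<sigma>)"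
      using varmax_attained[OF \<rho>' \<sigma>' t] by auto
    show ?thesis unfolding Y(2)[symmetric]
      by (rule order_trans[OF varf_channel_le[OF ch \<rho> \<sigma> Y(1) t] varf_le_varmax[OF \<rho> \<sigma> t adjoint_map_carrier]])
  qed
  show ?thesis
    unfolding relent_def case_prod_unfold
  proof (rule sum_log_ratio_mono)
    \<comment> \<open>Both totals are Tr \<rho>, by trace preservation; this is the equality that
      controls the behaviour at infinity.\<close>
    show "(\<Sum>k\<in>{..<din} \<times> {..<din}. overlap din \<rho> \<sigma> (fst k) (snd k) * eigval din \<rho> (fst k)) =
      (\<Sum>k\<in>{..<dout} \<times> {..<dout}. overlap dout (\<Phi> \<rho>) (\<Phi> \<sigma>) (fst k) (snd k) * eigval dout (\<Phi> \<rho>) (fst k))"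
      using sum_overlap_eigval[OF \<rho> \<sigma>] sum_overlap_eigval[OF \<rho>' \<sigma>'] channelD(3)[OF ch psdD(1)[OF \<rho>]]
      by (simp add: case_prod_unfold)
    show "(\<Sum>k\<in>{..<dout} \<times> {..<dout}. overlap dout (\<Phi> \<rho>) (\<Phi> \<sigma>) (fst k) (snd k) * ((eigval dout (\<Phi> \<rho>) (fst k))\<^sup>2 /
        (eigval dout (\<Phi> \<sigma>) (snd k) + t * eigval dout (\<Phi> \<rho>) (fst k))))
      \<le> (\<Sum>k\<in>{..<din} \<times> {..<din}. overlap din \<rho> \<sigma> (fst k) (snd k) * ((eigval din \<rho> (fst k))\<^sup>2 /
        (eigval din \<sigma> (snd k) + t * eigval din \<rho> (fst k))))" if "0 < t" for t
      using le[OF that] unfolding varmax_def case_prod_unfold .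
    show "0 \<le> overlap din \<rho> \<sigma> (fst k) (snd k) \<and> 0 \<le> eigval din \<rho> (fst k) \<and> 0 \<le> eigval din \<sigma> (snd k) \<and>
      (0 < overlap din \<rho> \<sigma> (fst k) (snd k) \<and> 0 < eigval din \<rho> (fst k) \<longrightarrow> 0 < eigval din \<sigma> (snd k))"
      if "k \<in> {..<din} \<times> {..<din}" for k
      using that overlap_support[OF \<rho> \<sigma> ac(1), of "fst k" "snd k"]
      by (auto simp: psd_eigval_nonneg[OF \<rho>] psd_eigval_nonneg[OF \<sigma>])
    show "0 \<le> overlap dout (\<Phi> \<rho>) (\<Phi> \<sigma>) (fst k) (snd k) \<and> 0 \<le> eigval dout (\<Phi> \<rho>) (fst k) \<and> 0 \<le> eigval dout (\<Phi> \<sigma>) (snd k) \<and>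
      (0 < overlap dout (\<Phi> \<rho>) (\<Phi> \<sigma>) (fst k) (snd k) \<and> 0 < eigval dout (\<Phi> \<rho>) (fst k) \<longrightarrow> 0 < eigval dout (\<Phi> \<sigma>) (snd k))"
      if "k \<in> {..<dout} \<times> {..<dout}" for k
      using that overlap_support[OF \<rho>' \<sigma>' ac(2), of "fst k" "snd k"]
      by (auto simp: psd_eigval_nonneg[OF \<rho>'] psd_eigval_nonneg[OF \<sigma>'])
  qed auto
qed

lemma vN_entropy_eigval:
  assumes "psd d \<rho>"
  shows "ln 2 * vN_entropy d \<rho> = - (\<Sum>i<d. eigval d \<rho> i * ln (eigval d \<rho> i))"
proof -
  have "ln 2 * eta (eigval d \<rho> i) = - (eigval d \<rho> i * ln (eigval d \<rho> i))" if "i < d" for i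
    using psd_eigval_nonneg[OF assms that] by (auto simp: eta_def log_def)
  then show ?thesis unfolding vN_entropy_spectral[OF psd_spectral[OF assms]]
    by (simp add: sum_distrib_left sum_negf[symmetric])
qed

text \<open>The overlaps sum to 1 over j, which leaves the entropy of \<rho> in nats. Summed over i
  against the eigenvalues of \<rho> they give the diagonal of \<rho> in the eigenbasis of \<sigma>,
  so the second sum is Tr(\<rho> ln \<sigma>), with \<open>ln 0 = 0\<close>.\<close>

lemma relent_entropy:
  assumes \<rho>: "psd d \<rho>" and \<sigma>: "psd d \<sigma>"
  shows "relent d \<rho> \<sigma> = - ln 2 * vN_entropy d \<rho>
     - (\<Sum>j<d. Re (qform d \<rho> (\<lambda>a. eigvec d \<sigma> $$ (a, j))) * ln (eigval d \<sigma> j))"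
proof -
  let ?w = "overlap d \<rho> \<sigma>" and ?p = "eigval d \<rho>" and ?q = "eigval d \<sigma>"
  have "relent d \<rho> \<sigma> = (\<Sum>i<d. \<Sum>j<d. ?w i j * (?p i * ln (?p i))) - (\<Sum>i<d. \<Sum>j<d. ?w i j * ?p i * ln (?q j))"
    unfolding relent_def sum.cartesian_product[symmetric] by (simp add: algebra_simps sum_subtractf)
  also have "(\<Sum>i<d. \<Sum>j<d. ?w i j * (?p i * ln (?p i))) = (\<Sum>i<d. ?p i * ln (?p i))"
    by (simp add: sum_distrib_right[symmetric] sum_overlap[OF \<rho> \<sigma>])
  also have "(\<Sum>i<d. \<Sum>j<d. ?w i j * ?p i * ln (?q j)) = (\<Sum>j<d. (\<Sum>i<d. ?w i j * ?p i) * ln (?q j))"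
    by (subst sum.swap) (simp add: sum_distrib_right)
  finally show ?thesis using vN_entropy_eigval[OF \<rho>] by (simp add: qform_eigvec[OF \<rho> \<sigma>])
qed

text \<open>Holevo quantity of the uniform ensemble, in bits: the mutual information between a
  uniformly chosen index and the system. Besides the set of all messages, the classes of messages
  that share a letter occur as index sets.\<close>

definition holevo :: "nat \<Rightarrow> 'a set \<Rightarrow> ('a \<Rightarrow> complex mat) \<Rightarrow> real" where
  "holevo d I \<rho> = vN_entropy d (mavg d I \<rho>) - (\<Sum>m\<in>I. vN_entropy d (\<rho> m)) / card I"

text \<open>Tr(\<rho>_m ln \<sigma>) is linear in the state, so for \<sigma> the mean these terms
  add up to \<open>card I\<close> times Tr(\<sigma> ln \<sigma>). The factor
  \<open>card I * ln 2\<close> undoes the averaging and passes from bits to nats.\<close>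

lemma holevo_relent:
  assumes I: "finite I" "I \<noteq> {}" and \<rho>: "\<And>m. m \<in> I \<Longrightarrow> psd d (\<rho> m)"
  shows "card I * ln 2 * holevo d I \<rho> = (\<Sum>m\<in>I. relent d (\<rho> m) (mavg d I \<rho>))"
proof -
  let ?\<sigma> = "mavg d I \<rho>"
  have \<sigma>: "psd d ?\<sigma>" by (rule psd_mavg[OF \<rho>])
  have c: "0 < card I" using I by (simp add: card_gt_0_iff)
  let ?v = "\<lambda>j a. eigvec d ?\<sigma> $$ (a, j)"
  have "(\<Sum>m\<in>I. relent d (\<rho> m) ?\<sigma>) = - ln 2 * (\<Sum>m\<in>I. vN_entropy d (\<rho> m))
     - (\<Sum>m\<in>I. \<Sum>j<d. Re (qform d (\<rho> m) (?v j)) * ln (eigval d ?\<sigma> j))"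
    by (simp add: relent_entropy[OF \<rho> \<sigma>] sum_subtractf sum_distrib_left sum_negf)
  also have "(\<Sum>m\<in>I. \<Sum>j<d. Re (qform d (\<rho> m) (?v j)) * ln (eigval d ?\<sigma> j))
      = (\<Sum>j<d. card I * (eigval d ?\<sigma> j * ln (eigval d ?\<sigma> j)))"
  proof (subst sum.swap, rule sum.cong[OF refl])
    fix j assume "j \<in> {..<d}"
    then have j: "j < d" by simp
    have "eigval d ?\<sigma> j = (\<Sum>m\<in>I. Re (qform d (\<rho> m) (?v j))) / card I"
      using qform_eigvec_self[OF \<sigma> j] by (simp add: qform_mavg Re_divide_of_nat Re_sum)
    then have "(\<Sum>m\<in>I. Re (qform d (\<rho> m) (?v j))) = card I * eigval d ?\<sigma> j" using c by simp
    then show "(\<Sum>m\<in>I. Re (qform d (\<rho> m) (?v j)) * ln (eigval d ?\<sigma> j)) = card I * (eigval d ?\<sigma> j * ln (eigval d ?\<sigma> j))"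
      by (simp add: sum_distrib_right[symmetric])
  qed
  also have "\<dots> = - real (card I) * (ln 2 * vN_entropy d ?\<sigma>)"
    by (simp add: vN_entropy_eigval[OF \<sigma>] sum_distrib_left sum_negf)
  finally show ?thesis using c by (simp add: holevo_def algebra_simps)
qed

text \<open>A channel commutes with averaging, so the output mean is the image of the input mean and
  monotonicity applies to each member separately. The domination it asks for holds on both sides,
  since every member is part of the mean.\<close>

theorem holevo_channel_le:
  assumes ch: "channel din dout \<Phi>" and I: "finite I" "I \<noteq> {}" and \<rho>: "\<And>m. m \<in> I \<Longrightarrow> psd din (\<rho> m)"
  shows "holevo dout I (\<lambda>m. \<Phi> (\<rho> m)) \<le> holevo din I \<rho>"
proof -
  have \<rho>': "psd dout (\<Phi> (\<rho> m))" if "m \<in> I" for m using channel_psd[OF ch \<rho>[OF that]] .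
  have av: "mavg dout I (\<lambda>m. \<Phi> (\<rho> m)) = \<Phi> (mavg din I \<rho>)"
    using channel_mavg[OF ch, of I \<rho>] psdD(1)[OF \<rho>] by simp
  have "relent dout (\<Phi> (\<rho> m)) (mavg dout I (\<lambda>m. \<Phi> (\<rho> m))) \<le> relent din (\<rho> m) (mavg din I \<rho>)" if "m \<in> I" for m
    using abs_cont_mavg[of I m din \<rho>] abs_cont_mavg[of I m dout "\<lambda>m. \<Phi> (\<rho> m)"] that I \<rho> \<rho>'
    unfolding av by (intro relent_channel_le[OF ch] psd_mavg) auto
  then have "card I * ln 2 * holevo dout I (\<lambda>m. \<Phi> (\<rho> m)) \<le> card I * ln 2 * holevo din I \<rho>"
    using holevo_relent[of I din \<rho>, OF I \<rho>] holevo_relent[of I dout "\<lambda>m. \<Phi> (\<rho> m)", OF I \<rho>']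
    by (simp add: sum_mono)
  moreover have "0 < card I * ln (2::real)" using I by (simp add: card_gt_0_iff)
  ultimately show ?thesis by (simp only: mult_le_cancel_left_pos)
qed

section \<open>Measurements, success probability and information\<close>

lemma mtrace_diag_conj:
  assumes "M \<in> carrier_mat d d" "G \<in> carrier_mat d d"
  shows "mtrace d (M * (G * diagm d x * dagger G)) = (\<Sum>k<d. of_real (x k) * qform d M (\<lambda>a. G $$ (a, k)))"
proof -
  have "mtrace d (M * (G * diagm d x * dagger G)) = mtrace d ((M * G * diagm d x) * dagger G)"
    using assms by (simp add: assoc_mult_mat[of _ d d _ d _ d])
  also have "\<dots> = mtrace d (dagger G * (M * G * diagm d x))"
    using assms by (intro mtrace_mult_commute) auto
  also have "\<dots> = mtrace d ((dagger G * M * G) * diagm d x)"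
    using assms by (simp add: assoc_mult_mat[of _ d d _ d _ d])
  also have "\<dots> = mtrace d (diagm d x * (dagger G * M * G))"
    using assms by (intro mtrace_mult_commute) auto
  also have "\<dots> = (\<Sum>k<d. of_real (x k) * (dagger G * M * G) $$ (k, k))"
    using assms by (simp add: mtrace_mult_sum diagm_def if_distrib[of "\<lambda>x. x * _"] sum.delta cong: if_cong)
  finally show ?thesis using assms by (simp add: conj_diag_qform)
qed

text \<open>This is ln z \<le> z - 1 at z = M t / s: a lower bound on one term of the classical
  relative entropy that is linear in t and tangent where M t = s. The free slope M will be the
  number of messages.\<close>

lemma log_ratio_ge:
  fixes s t M :: real
  assumes "0 \<le> s" "0 \<le> t" "0 < M" "0 < s \<longrightarrow> 0 < t"
  shows "s * ln M + s - M * t \<le> s * (ln s - ln t)"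
proof (cases "s = 0")
  case False
  then have s: "0 < s" "0 < t" using assms by auto
  have "ln (M * t / s) \<le> M * t / s - 1" using s assms by (intro ln_le_minus_one) auto
  then have "s * ln (M * t / s) \<le> s * (M * t / s - 1)" using s by (intro mult_left_mono) auto
  then show ?thesis using s assms by (simp add: ln_mult ln_div algebra_simps)
qed (use assms in auto)

text \<open>Data processing for the two-outcome measurement with effects \<Lambda>, 1 - \<Lambda>:
  a test operator with value a on \<Lambda> and b on 1 - \<Lambda> reaches the classical optimum.\<close>
lemma relent_test_ge:
  assumes \<rho>: "psd d \<rho>" and \<sigma>: "psd d \<sigma>" and ac: "abs_cont d \<rho> \<sigma>" and \<Lambda>: "psd d \<Lambda>"
    and \<Lambda>1: "\<And>v. Re (qform d \<Lambda> v) \<le> Re (qform d (1\<^sub>m d) v)"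
    and tr: "Re (mtrace d \<rho>) = 1" "Re (mtrace d \<sigma>) = 1" and M: "0 < M"
  shows "Re (mtrace d (\<Lambda> * \<rho>)) * ln M + (1 - M) * Re (mtrace d (\<Lambda> * \<sigma>)) \<le> relent d \<rho> \<sigma>"
proof -
  note S = spectralD[OF psd_spectral[OF \<Lambda>]]
  let ?G = "eigvec d \<Lambda>" and ?\<mu> = "eigval d \<Lambda>"
  note c\<rho> = psdD(1)[OF \<rho>] and c\<sigma> = psdD(1)[OF \<sigma>]
  have \<mu>0: "0 \<le> ?\<mu> k" if "k < d" for k using psd_eigval_nonneg[OF \<Lambda> that] .
  have one: "?G * diagm d (\<lambda>_. 1) * dagger ?G = 1\<^sub>m d"
  proof -
    have "diagm d (\<lambda>_. 1) = 1\<^sub>m d" by (rule eq_matI) (auto simp: diagm_def)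
    then show ?thesis using S(2) unitaryD(3)[OF S(1)] by (simp add: right_mult_one_mat[of _ d d])
  qed
  have \<mu>1: "?\<mu> k \<le> 1" if "k < d" for k
  proof -
    have "qform d (1\<^sub>m d) (\<lambda>a. ?G $$ (a, k)) = 1"
      using conj_diag_qform[OF one_carrier_mat S(2) that] unitaryD(2)[OF S(1)] that S(2)
      by (simp add: right_mult_one_mat[of _ d d])
    then show ?thesis using \<Lambda>1[of "\<lambda>a. ?G $$ (a, k)"] qform_eigvec_self[OF \<Lambda> that] by simp
  qed
  define r where "r k = Re (qform d \<rho> (\<lambda>a. ?G $$ (a, k)))" for k
  define s where "s k = Re (qform d \<sigma> (\<lambda>a. ?G $$ (a, k)))" for k
  have r0: "0 \<le> r k" and s0: "0 \<le> s k" for k unfolding r_def s_def using psdD(3)[OF \<rho>] psdD(3)[OF \<sigma>] by auto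
  have T\<rho>: "Re (mtrace d (\<rho> * (?G * diagm d x * dagger ?G))) = (\<Sum>k<d. x k * r k)" for x
    unfolding mtrace_diag_conj[OF c\<rho> S(2)] r_def by (simp add: Re_sum)
  have T\<sigma>: "Re (mtrace d (\<sigma> * (?G * diagm d x * dagger ?G))) = (\<Sum>k<d. x k * s k)" for x
    unfolding mtrace_diag_conj[OF c\<sigma> S(2)] s_def by (simp add: Re_sum)
  \<comment> \<open>Probabilities of the outcomes \<Lambda> (\<open>True\<close>) and 1 - \<Lambda>
    (\<open>False\<close>) under \<rho>, and next under \<sigma>, written in the eigenbasis of
    \<Lambda>, where both effects are diagonal.\<close>
  define R where "R b = (\<Sum>k<d. (if b then ?\<mu> k else 1 - ?\<mu> k) * r k)" for b
  define Q where "Q b = (\<Sum>k<d. (if b then ?\<mu> k else 1 - ?\<mu> k) * s k)" for b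
  have RT: "R True = Re (mtrace d (\<Lambda> * \<rho>))" and QT: "Q True = Re (mtrace d (\<Lambda> * \<sigma>))"
    using T\<rho>[of ?\<mu>] T\<sigma>[of ?\<mu>] S(3,4) c\<rho> c\<sigma> mtrace_mult_commute[of \<Lambda> d] by (auto simp: R_def Q_def)
  have "R True + R False = 1" "Q True + Q False = 1"
    using T\<rho>[of "\<lambda>_. 1"] T\<sigma>[of "\<lambda>_. 1"] tr c\<rho> c\<sigma> unfolding one
    by (simp_all add: R_def Q_def sum.distrib[symmetric] algebra_simps right_mult_one_mat[of _ d d])
  then have RF: "R False = 1 - R True" and QF: "Q False = 1 - Q True" by auto
  have R0: "0 \<le> R b" and Q0: "0 \<le> Q b" for b
    unfolding R_def Q_def using r0 s0 \<mu>0 \<mu>1 by (auto intro!: sum_nonneg)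
  have supp: "0 < R b \<longrightarrow> 0 < Q b" for b
  proof -
    from ac obtain c where "\<And>v. Re (qform d \<rho> v) \<le> c * Re (qform d \<sigma> v)" by (auto simp: abs_cont_def)
    then have rs: "r k \<le> c * s k" for k unfolding r_def s_def .
    have "(if b then ?\<mu> k else 1 - ?\<mu> k) * r k \<le> (if b then ?\<mu> k else 1 - ?\<mu> k) * (c * s k)" if "k < d" for k
      using rs[of k] \<mu>0[OF that] \<mu>1[OF that] by (intro mult_left_mono) auto
    then have "R b \<le> (\<Sum>k<d. (if b then ?\<mu> k else 1 - ?\<mu> k) * (c * s k))"
      unfolding R_def by (intro sum_mono) auto
    also have "\<dots> = c * Q b" by (simp add: Q_def sum_distrib_left mult.left_commute)
    finally show ?thesis using Q0[of b] by (cases "Q b = 0") auto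
  qed
  have le: "(\<Sum>b\<in>UNIV. 1 * ((R b)\<^sup>2 / (Q b + t * R b))) \<le> varmax d t \<rho> \<sigma>" if t: "0 < t" for t
  proof -
    \<comment> \<open>The maximiser of 2 z R - z^2 (Q + t R) for each outcome; \<open>X\<close>
      below is \<open>z True\<close> times \<Lambda> plus \<open>z False\<close> times 1 -
      \<Lambda>.\<close>
    define z where "z b = R b / (Q b + t * R b)" for b
    define x where "x k = ?\<mu> k * z True + (1 - ?\<mu> k) * z False" for k
    define X where "X = ?G * diagm d x * dagger ?G"
    have X: "X \<in> carrier_mat d d" unfolding X_def using S(2) by auto
    have dX: "dagger X = X"
    proof -
      have "dagger (diagm d x) = diagm d x" by (rule eq_matI) (auto simp: diagm_def)
      then show ?thesis unfolding X_def using S(2)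
        by (simp add: dagger_mult[of _ d d _ d] assoc_mult_mat[of _ d d _ d _ d])
    qed
    have XX: "X * X = ?G * diagm d (\<lambda>k. (x k)\<^sup>2) * dagger ?G"
    proof -
      have "diagm d x * diagm d x = diagm d (\<lambda>k. (x k)\<^sup>2)"
        by (rule eq_matI) (auto simp: index_mult_sum[of _ d d _ d] diagm_def power2_eq_square
            if_distrib[of "\<lambda>x. x * _"] sum.delta cong: if_cong)
      moreover have "X * X = ?G * (diagm d x * diagm d x) * dagger ?G"
        unfolding X_def using S(2) by (simp add: assoc_mult_mat[of _ d d _ d _ d] unitary_cancel[OF S(1)])
      ultimately show ?thesis by simp
    qed
    \<comment> \<open>Convexity of the square. It bounds X^2 by the same combination of \<Lambda>
      and 1 - \<Lambda> with squared coefficients; the defect measures how far \<Lambda> is from a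
      projection.\<close>
    have cvx: "(x k)\<^sup>2 \<le> ?\<mu> k * (z True)\<^sup>2 + (1 - ?\<mu> k) * (z False)\<^sup>2" if "k < d" for k
    proof -
      have "0 \<le> ?\<mu> k * (1 - ?\<mu> k) * (z True - z False)\<^sup>2" using \<mu>0[OF that] \<mu>1[OF that] by simp
      also have "\<dots> = ?\<mu> k * (z True)\<^sup>2 + (1 - ?\<mu> k) * (z False)\<^sup>2 - (x k)\<^sup>2"
        unfolding x_def by (simp add: power2_eq_square algebra_simps)
      finally show ?thesis by simp
    qed
    have sq: "(\<Sum>k<d. (x k)\<^sup>2 * f k) \<le> (z True)\<^sup>2 * (\<Sum>k<d. ?\<mu> k * f k) + (z False)\<^sup>2 * (\<Sum>k<d. (1 - ?\<mu> k) * f k)"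
      if f: "\<And>k. 0 \<le> f k" for f
    proof -
      have "(\<Sum>k<d. (x k)\<^sup>2 * f k) \<le> (\<Sum>k<d. (?\<mu> k * (z True)\<^sup>2 + (1 - ?\<mu> k) * (z False)\<^sup>2) * f k)"
        using cvx f by (intro sum_mono mult_right_mono) auto
      also have "\<dots> = (z True)\<^sup>2 * (\<Sum>k<d. ?\<mu> k * f k) + (z False)\<^sup>2 * (\<Sum>k<d. (1 - ?\<mu> k) * f k)"
        unfolding sum_distrib_left sum.distrib[symmetric] by (intro sum.cong refl) (simp add: algebra_simps)
      finally show ?thesis .
    qed
    have lin: "(\<Sum>k<d. x k * r k) = z True * R True + z False * R False"
      unfolding R_def sum_distrib_left sum.distrib[symmetric]
      by (intro sum.cong refl) (simp add: x_def algebra_simps)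
    have v: "varf d t X \<rho> \<sigma> = 2 * (\<Sum>k<d. x k * r k) - (\<Sum>k<d. (x k)\<^sup>2 * s k) - t * (\<Sum>k<d. (x k)\<^sup>2 * r k)"
      unfolding varf_def dX XX T\<rho> T\<sigma> mtrace_mult_commute[OF X c\<rho>] by (simp add: X_def T\<rho>)
    have zz: "(R b)\<^sup>2 / (Q b + t * R b) = 2 * (z b * R b) - (z b)\<^sup>2 * (Q b + t * R b)" for b
    proof -
      have "u\<^sup>2 / c = 2 * (u / c * u) - (u / c)\<^sup>2 * c" for u c :: real
        by (cases "c = 0") (auto simp: power2_eq_square field_simps)
      then show ?thesis unfolding z_def .
    qed
    have "(\<Sum>b\<in>UNIV. 1 * ((R b)\<^sup>2 / (Q b + t * R b)))
       = 2 * (z True * R True + z False * R False) - ((z True)\<^sup>2 * Q True + (z False)\<^sup>2 * Q False)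
         - t * ((z True)\<^sup>2 * R True + (z False)\<^sup>2 * R False)"
      by (simp add: UNIV_bool zz algebra_simps)
    also have "\<dots> \<le> varf d t X \<rho> \<sigma>"
      unfolding v lin using sq[of s, OF s0] sq[of r, OF r0] t
      by (intro diff_mono order_refl mult_left_mono) (auto simp: R_def Q_def)
    also have "\<dots> \<le> varmax d t \<rho> \<sigma>" by (rule varf_le_varmax[OF \<rho> \<sigma> t X])
    finally show ?thesis .
  qed
  have "(\<Sum>b\<in>UNIV. 1 * (R b * (ln (R b) - ln (Q b)))) \<le> relent d \<rho> \<sigma>"
    unfolding relent_def case_prod_unfold
  proof (rule sum_log_ratio_mono)
    show "(\<Sum>k\<in>{..<d} \<times> {..<d}. overlap d \<rho> \<sigma> (fst k) (snd k) * eigval d \<rho> (fst k)) = (\<Sum>b\<in>UNIV. 1 * R b)"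
      using sum_overlap_eigval[OF \<rho> \<sigma>] tr RF by (simp add: case_prod_unfold UNIV_bool)
    show "(\<Sum>b\<in>UNIV. 1 * ((R b)\<^sup>2 / (Q b + t * R b))) \<le> (\<Sum>k\<in>{..<d} \<times> {..<d}. overlap d \<rho> \<sigma> (fst k) (snd k) *
        ((eigval d \<rho> (fst k))\<^sup>2 / (eigval d \<sigma> (snd k) + t * eigval d \<rho> (fst k))))" if "0 < t" for t
      using le[OF that] unfolding varmax_def case_prod_unfold .
    show "0 \<le> overlap d \<rho> \<sigma> (fst k) (snd k) \<and> 0 \<le> eigval d \<rho> (fst k) \<and> 0 \<le> eigval d \<sigma> (snd k) \<and>
      (0 < overlap d \<rho> \<sigma> (fst k) (snd k) \<and> 0 < eigval d \<rho> (fst k) \<longrightarrow> 0 < eigval d \<sigma> (snd k))"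
      if "k \<in> {..<d} \<times> {..<d}" for k
      using that overlap_support[OF \<rho> \<sigma> ac, of "fst k" "snd k"]
      by (auto simp: psd_eigval_nonneg[OF \<rho>] psd_eigval_nonneg[OF \<sigma>])
  qed (use R0 Q0 supp in auto)
  \<comment> \<open>Slope M on acceptance and slope 1 on rejection: in the sum the linear terms in R
    and the constants cancel, leaving R ln M + (1 - M) Q for acceptance.\<close>
  moreover have "R True * ln M + R True - M * Q True \<le> R True * (ln (R True) - ln (Q True))"
    using R0 Q0 supp M by (intro log_ratio_ge) auto
  moreover have "R False * ln 1 + R False - 1 * Q False \<le> R False * (ln (R False) - ln (Q False))"
    using R0 Q0 supp by (intro log_ratio_ge) auto
  ultimately show ?thesis using RF QF unfolding RT[symmetric] QT[symmetric]
    by (simp add: UNIV_bool algebra_simps)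
qed

text \<open>Each state is tested against the mean with its own effect. The effects sum to the
  identity, so on the mean the acceptance probabilities add up to 1 and the penalties to 1 - M.
  After division by M ln 2 the loss is below 1 / ln 2 bits.\<close>

theorem holevo_ge_success:
  fixes \<Lambda> :: "nat \<Rightarrow> complex mat"
  assumes M: "0 < M" and \<rho>: "\<And>m. m < M \<Longrightarrow> density d (\<rho> m)" and \<Lambda>: "\<And>m. m < M \<Longrightarrow> psd d (\<Lambda> m)"
    and \<Lambda>1: "\<And>i j. i < d \<Longrightarrow> j < d \<Longrightarrow> (\<Sum>m<M. \<Lambda> m $$ (i, j)) = (if i = j then 1 else 0)"
  shows "(1 / M) * (\<Sum>m<M. Re (mtrace d (\<Lambda> m * \<rho> m))) * log 2 M - 1 / ln 2 \<le> holevo d {..<M} \<rho>"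
proof -
  let ?I = "{..<M}" and ?\<sigma> = "mavg d {..<M} \<rho>"
  have \<rho>': "psd d (\<rho> m)" "mtrace d (\<rho> m) = 1" if "m \<in> ?I" for m using \<rho>[of m] that by (auto simp: density_def)
  have \<sigma>: "psd d ?\<sigma>" by (rule psd_mavg[OF \<rho>'(1)])
  have tr\<sigma>: "mtrace d ?\<sigma> = 1" using M by (simp add: mtrace_mavg \<rho>')
  have sumq: "(\<Sum>m<M. qform d (\<Lambda> m) v) = qform d (1\<^sub>m d) v" for v
  proof -
    have "(\<Sum>m<M. qform d (\<Lambda> m) v) = (\<Sum>i<d. \<Sum>m<M. \<Sum>j<d. cnj (v i) * \<Lambda> m $$ (i, j) * v j)"
      unfolding qform_def by (rule sum.swap)
    also have "\<dots> = (\<Sum>i<d. \<Sum>j<d. \<Sum>m<M. cnj (v i) * \<Lambda> m $$ (i, j) * v j)"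
      by (rule sum.cong[OF refl], rule sum.swap)
    also have "\<dots> = qform d (1\<^sub>m d) v" unfolding qform_def
      by (intro sum.cong refl) (simp add: sum_distrib_left[symmetric] sum_distrib_right[symmetric] \<Lambda>1)
    finally show ?thesis .
  qed
  have le1: "Re (qform d (\<Lambda> m) v) \<le> Re (qform d (1\<^sub>m d) v)" if "m < M" for m v
  proof -
    have "Re (qform d (\<Lambda> m) v) \<le> (\<Sum>m<M. Re (qform d (\<Lambda> m) v))"
      using that psdD(3)[OF \<Lambda>] by (intro member_le_sum) auto
    then show ?thesis by (simp add: sumq[symmetric] Re_sum)
  qed
  have one: "(\<Sum>m<M. Re (mtrace d (\<Lambda> m * ?\<sigma>))) = 1"
  proof -
    have "(\<Sum>m<M. mtrace d (\<Lambda> m * ?\<sigma>)) = (\<Sum>m<M. \<Sum>i<d. \<Sum>j<d. \<Lambda> m $$ (i, j) * ?\<sigma> $$ (j, i))"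
      using psdD(1)[OF \<Lambda>] by (intro sum.cong refl mtrace_mult_sum) auto
    also have "\<dots> = (\<Sum>i<d. \<Sum>m<M. \<Sum>j<d. \<Lambda> m $$ (i, j) * ?\<sigma> $$ (j, i))" by (rule sum.swap)
    also have "\<dots> = (\<Sum>i<d. \<Sum>j<d. \<Sum>m<M. \<Lambda> m $$ (i, j) * ?\<sigma> $$ (j, i))"
      by (rule sum.cong[OF refl], rule sum.swap)
    also have "\<dots> = (\<Sum>i<d. ?\<sigma> $$ (i, i))"
      by (intro sum.cong refl) (simp add: sum_distrib_right[symmetric] \<Lambda>1 if_distrib[of "\<lambda>x. x * _"] sum.delta cong: if_cong)
    finally show ?thesis using tr\<sigma> by (simp add: mtrace_def flip: Re_sum)
  qed
  have "(\<Sum>m<M. Re (mtrace d (\<Lambda> m * \<rho> m)) * ln M + (1 - real M) * Re (mtrace d (\<Lambda> m * ?\<sigma>))) \<le> (\<Sum>m<M. relent d (\<rho> m) ?\<sigma>)"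
    using \<rho>' \<Lambda> le1 tr\<sigma> M abs_cont_mavg[of ?I _ d \<rho>]
    by (intro sum_mono relent_test_ge \<sigma>) auto
  also have "\<dots> = M * ln 2 * holevo d ?I \<rho>"
    by (subst holevo_relent[symmetric]) (use \<rho>' M in auto)
  finally have "(\<Sum>m<M. Re (mtrace d (\<Lambda> m * \<rho> m))) * ln M + (1 - real M) \<le> M * ln 2 * holevo d ?I \<rho>"
    by (simp add: sum.distrib sum_distrib_left[symmetric] sum_distrib_right[symmetric] one)
  then have "(\<Sum>m<M. Re (mtrace d (\<Lambda> m * \<rho> m))) * ln M - M \<le> M * ln 2 * holevo d ?I \<rho>" by simp
  then have "((\<Sum>m<M. Re (mtrace d (\<Lambda> m * \<rho> m))) * ln M - M) / (M * ln 2) \<le> holevo d ?I \<rho>"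
    using M by (simp add: divide_le_eq mult.commute)
  then show ?thesis using M by (simp add: log_def diff_divide_distrib)
qed

section \<open>Classical-quantum states and the converse\<close>

lemma prod_index_eq_iff:
  "i < k * (d::nat) \<Longrightarrow> i div d = j div d \<and> i mod d = j mod d \<longleftrightarrow> i = j"
  by (metis div_mult_mod_eq)

definition block_diag :: "nat \<Rightarrow> nat \<Rightarrow> (nat \<Rightarrow> complex mat) \<Rightarrow> complex mat" where
  "block_diag k d F = mat (k * d) (k * d)
     (\<lambda>(i, j). if i div d = j div d then F (i div d) $$ (i mod d, j mod d) else 0)"

lemma block_diag_carrier [simp, intro]: "block_diag k d F \<in> carrier_mat (k * d) (k * d)"
  by (simp add: block_diag_def)

lemma block_diag_cong: "(\<And>x. x < k \<Longrightarrow> F x = G x) \<Longrightarrow> block_diag k d F = block_diag k d G"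
  by (rule eq_matI) (auto simp: block_diag_def product_index_div_mod)

lemma block_diag_mult:
  assumes "\<And>x. x < k \<Longrightarrow> F x \<in> carrier_mat d d" "\<And>x. x < k \<Longrightarrow> G x \<in> carrier_mat d d"
  shows "block_diag k d F * block_diag k d G = block_diag k d (\<lambda>x. F x * G x)"
proof (rule eq_matI)
  fix i j assume "i < dim_row (block_diag k d (\<lambda>x. F x * G x))" "j < dim_col (block_diag k d (\<lambda>x. F x * G x))"
  then have ij: "i < k * d" "j < k * d" by (auto simp: block_diag_def)
  note im = product_index_div_mod[OF ij(1)] and jm = product_index_div_mod[OF ij(2)]
  let ?f = "\<lambda>r a. if i div d = r \<and> r = j div d then F r $$ (i mod d, a) * G r $$ (a, j mod d) else 0"
  have "(block_diag k d F * block_diag k d G) $$ (i, j) = (\<Sum>r<k. \<Sum>a<d. ?f r a)"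
    unfolding index_mult_sum[OF block_diag_carrier block_diag_carrier ij] sum_product_index
    using ij by (intro sum.cong refl) (auto simp: block_diag_def product_index_less)
  also have "\<dots> = (\<Sum>r<k. if r = i div d then \<Sum>a<d. ?f r a else 0)"
    by (intro sum.cong refl) auto
  also have "\<dots> = (\<Sum>a<d. ?f (i div d) a)" using im by (simp add: sum.delta)
  also have "\<dots> = block_diag k d (\<lambda>x. F x * G x) $$ (i, j)"
    using ij im jm by (auto simp: block_diag_def index_mult_sum[OF assms(1) assms(2)])
  finally show "(block_diag k d F * block_diag k d G) $$ (i, j) = block_diag k d (\<lambda>x. F x * G x) $$ (i, j)" .
qed (auto simp: block_diag_def)

lemma block_diag_dagger:
  assumes "\<And>x. x < k \<Longrightarrow> F x \<in> carrier_mat d d"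
  shows "dagger (block_diag k d F) = block_diag k d (\<lambda>x. dagger (F x))"
proof (rule eq_matI)
  fix i j assume "i < dim_row (block_diag k d (\<lambda>x. dagger (F x)))" "j < dim_col (block_diag k d (\<lambda>x. dagger (F x)))"
  then have ij: "i < k * d" "j < k * d" by (auto simp: block_diag_def)
  then show "dagger (block_diag k d F) $$ (i, j) = block_diag k d (\<lambda>x. dagger (F x)) $$ (i, j)"
    using product_index_div_mod[OF ij(1)] product_index_div_mod[OF ij(2)] assms[of "i div d"]
    by (auto simp: block_diag_def)
qed (auto simp: block_diag_def)

lemma block_diag_diagm: "block_diag k d (\<lambda>x. diagm d (q x)) = diagm (k * d) (\<lambda>i. q (i div d) (i mod d))"
  by (rule eq_matI) (use prod_index_eq_iff in \<open>auto simp: block_diag_def diagm_def product_index_div_mod\<close>)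

lemma block_diag_one: "block_diag k d (\<lambda>x. 1\<^sub>m d) = 1\<^sub>m (k * d)"
  by (rule eq_matI) (use prod_index_eq_iff in \<open>auto simp: block_diag_def product_index_div_mod\<close>)

lemma spectral_block_diag:
  assumes S: "\<And>x. x < k \<Longrightarrow> spectral d (F x) (U x) (q x)"
  shows "spectral (k * d) (block_diag k d F) (block_diag k d U) (\<lambda>i. q (i div d) (i mod d))"
proof -
  note S' = spectralD[OF S]
  have "dagger (block_diag k d U) * block_diag k d U = block_diag k d (\<lambda>x. dagger (U x) * U x)"
    using S'(2) by (simp add: block_diag_dagger block_diag_mult)
  also have "\<dots> = 1\<^sub>m (k * d)"
    unfolding block_diag_one[symmetric] using unitaryD(2)[OF S'(1)] by (intro block_diag_cong)
  finally have "unitary (k * d) (block_diag k d U)" by (simp add: unitary_def)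
  moreover have "block_diag k d F = block_diag k d U * diagm (k * d) (\<lambda>i. q (i div d) (i mod d)) * dagger (block_diag k d U)"
  proof -
    have "block_diag k d F = block_diag k d (\<lambda>x. U x * diagm d (q x) * dagger (U x))"
      by (intro block_diag_cong) (rule S'(4))
    also have "\<dots> = block_diag k d U * block_diag k d (\<lambda>x. diagm d (q x)) * dagger (block_diag k d U)"
      using S'(2) by (simp add: block_diag_dagger block_diag_mult)
    finally show ?thesis unfolding block_diag_diagm .
  qed
  ultimately show ?thesis by (simp add: spectral_def)
qed

lemma eta_mult: "0 \<le> a \<Longrightarrow> 0 \<le> b \<Longrightarrow> eta (a * b) = b * eta a + a * eta b"
  by (auto simp: eta_def log_mult mult_le_0_iff algebra_simps)

lemma densityD:
  assumes "density d \<rho>" shows "psd d \<rho>" "\<rho> \<in> carrier_mat d d" "mtrace d \<rho> = 1"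
  using assms psdD(1) by (auto simp: density_def)

text \<open>The eigenvalues are the products of \<open>p x\<close> with those of
  \<open>\<sigma> x\<close>; \<open>eta\<close> obeys a product rule, and unit trace removes the
  weights in front of \<open>eta (p x)\<close>.\<close>

lemma vN_entropy_cq_state:
  assumes p: "\<And>x. x < k \<Longrightarrow> 0 \<le> p x" and \<sigma>: "\<And>x. x < k \<Longrightarrow> density d (\<sigma> x)"
  shows "vN_entropy (k * d) (cq_state k d p \<sigma>) = (\<Sum>x<k. eta (p x)) + (\<Sum>x<k. p x * vN_entropy d (\<sigma> x))"
proof -
  note \<sigma>' = densityD[OF \<sigma>]
  have "cq_state k d p \<sigma> = block_diag k d (\<lambda>x. of_real (p x) \<cdot>\<^sub>m \<sigma> x)"
  proof (rule eq_matI)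
    fix i j assume "i < dim_row (block_diag k d (\<lambda>x. of_real (p x) \<cdot>\<^sub>m \<sigma> x))" "j < dim_col (block_diag k d (\<lambda>x. of_real (p x) \<cdot>\<^sub>m \<sigma> x))"
    then have ij: "i < k * d" "j < k * d" by (auto simp: block_diag_def)
    then show "cq_state k d p \<sigma> $$ (i, j) = block_diag k d (\<lambda>x. of_real (p x) \<cdot>\<^sub>m \<sigma> x) $$ (i, j)"
      using product_index_div_mod[OF ij(1)] product_index_div_mod[OF ij(2)] \<sigma>'(2)[of "i div d"]
      by (auto simp: block_diag_def cq_state_def)
  qed (auto simp: block_diag_def cq_state_def)
  moreover have "spectral d (of_real (p x) \<cdot>\<^sub>m \<sigma> x) (eigvec d (\<sigma> x)) (\<lambda>i. p x * eigval d (\<sigma> x) i)" if x: "x < k" for x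
  proof -
    note S = spectralD[OF psd_spectral[OF \<sigma>'(1)[OF x]]]
    have "diagm d (\<lambda>i. p x * eigval d (\<sigma> x) i) = of_real (p x) \<cdot>\<^sub>m diagm d (eigval d (\<sigma> x))"
      by (rule eq_matI) (auto simp: diagm_def)
    then have "eigvec d (\<sigma> x) * diagm d (\<lambda>i. p x * eigval d (\<sigma> x) i) * dagger (eigvec d (\<sigma> x))
       = of_real (p x) \<cdot>\<^sub>m (eigvec d (\<sigma> x) * diagm d (eigval d (\<sigma> x)) * dagger (eigvec d (\<sigma> x)))"
      using S(2) by (simp add: mult_smult_distrib[of _ d d _ d] mult_smult_assoc_mat[of _ d d _ d])
    then show ?thesis unfolding spectral_def using S(1) S(4)[symmetric] by simp
  qed
  ultimately have "vN_entropy (k * d) (cq_state k d p \<sigma>)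
      = (\<Sum>i<k * d. eta (p (i div d) * eigval d (\<sigma> (i div d)) (i mod d)))"
    using vN_entropy_spectral[OF spectral_block_diag[of k d "\<lambda>x. of_real (p x) \<cdot>\<^sub>m \<sigma> x"
      "\<lambda>x. eigvec d (\<sigma> x)" "\<lambda>x i. p x * eigval d (\<sigma> x) i"]] by simp
  also have "\<dots> = (\<Sum>x<k. \<Sum>a<d. eta (p x * eigval d (\<sigma> x) a))"
    unfolding sum_product_index by (intro sum.cong refl) simp
  also have "\<dots> = (\<Sum>x<k. eta (p x) + p x * vN_entropy d (\<sigma> x))"
  proof (rule sum.cong[OF refl])
    fix x assume "x \<in> {..<k}"
    then have x: "x < k" by simp
    have "(\<Sum>a<d. eta (p x * eigval d (\<sigma> x) a)) = (\<Sum>a<d. eigval d (\<sigma> x) a * eta (p x) + p x * eta (eigval d (\<sigma> x) a))"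
      using p[OF x] psd_eigval_nonneg[OF \<sigma>'(1)[OF x]] by (intro sum.cong refl eta_mult) auto
    then show "(\<Sum>a<d. eta (p x * eigval d (\<sigma> x) a)) = eta (p x) + p x * vN_entropy d (\<sigma> x)"
      using sum_eigval[OF \<sigma>'(1)[OF x]] \<sigma>'(3)[OF x] vN_entropy_spectral[OF psd_spectral[OF \<sigma>'(1)[OF x]]]
      by (simp add: sum.distrib sum_distrib_left sum_distrib_right[symmetric])
  qed
  finally show ?thesis by (simp add: sum.distrib)
qed

section \<open>Marginals of classical-quantum states\<close>

definition mixture :: "nat \<Rightarrow> nat \<Rightarrow> (nat \<Rightarrow> real) \<Rightarrow> (nat \<Rightarrow> complex mat) \<Rightarrow> complex mat" where
  "mixture k d p \<sigma> = mat d d (\<lambda>ij. \<Sum>x<k. of_real (p x) * \<sigma> x $$ ij)"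

lemma ptrace1_cq_state: "ptrace1 k d (cq_state k d p \<sigma>) = mixture k d p \<sigma>"
  by (rule eq_matI) (auto simp: ptrace1_def cq_state_def mixture_def product_index_less intro!: sum.cong)

lemma ptrace2_cq_state: "ptrace2 (k * r) d (cq_state k (r * d) p \<sigma>) = cq_state k r p (\<lambda>x. ptrace2 r d (\<sigma> x))"
proof (rule eq_matI)
  fix i j assume "i < dim_row (cq_state k r p (\<lambda>x. ptrace2 r d (\<sigma> x)))" "j < dim_col (cq_state k r p (\<lambda>x. ptrace2 r d (\<sigma> x)))"
  then have ij: "i < k * r" "j < k * r" by (auto simp: cq_state_def)
  have dm: "(n * d + b) div (r * d) = n div r" "(n * d + b) mod (r * d) = (n mod r) * d + b" if "b < d" for n b
    using that by (simp_all add: mult.commute[of r d] div_mult2_eq mod_mult2_eq)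
  have lt: "n * d + b < k * (r * d)" if "n < k * r" "b < d" for n b
    using product_index_less[OF that] by (simp add: mult.assoc)
  have "(\<Sum>b<d. cq_state k (r * d) p \<sigma> $$ (i * d + b, j * d + b)) =
      (\<Sum>b<d. if i div r = j div r then of_real (p (i div r)) * \<sigma> (i div r) $$ ((i mod r) * d + b, (j mod r) * d + b) else 0)"
    using ij by (intro sum.cong refl) (simp add: cq_state_def dm lt)
  then show "ptrace2 (k * r) d (cq_state k (r * d) p \<sigma>) $$ (i, j) = cq_state k r p (\<lambda>x. ptrace2 r d (\<sigma> x)) $$ (i, j)"
    using ij product_index_div_mod[OF ij(1)] product_index_div_mod[OF ij(2)]
    by (auto simp: ptrace2_def cq_state_def sum_distrib_left)
qed (auto simp: cq_state_def ptrace2_def)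

lemma ptrace2_mixture: "ptrace2 r d (mixture k (r * d) p \<sigma>) = mixture k r p (\<lambda>x. ptrace2 r d (\<sigma> x))"
proof (rule eq_matI)
  fix i j assume "i < dim_row (mixture k r p (\<lambda>x. ptrace2 r d (\<sigma> x)))" "j < dim_col (mixture k r p (\<lambda>x. ptrace2 r d (\<sigma> x)))"
  then have ij: "i < r" "j < r" by (auto simp: mixture_def)
  then have "ptrace2 r d (mixture k (r * d) p \<sigma>) $$ (i, j)
      = (\<Sum>b<d. \<Sum>x<k. of_real (p x) * \<sigma> x $$ (i * d + b, j * d + b))"
    by (simp add: ptrace2_def mixture_def product_index_less)
  also have "\<dots> = (\<Sum>x<k. \<Sum>b<d. of_real (p x) * \<sigma> x $$ (i * d + b, j * d + b))" by (rule sum.swap)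
  finally show "ptrace2 r d (mixture k (r * d) p \<sigma>) $$ (i, j) = mixture k r p (\<lambda>x. ptrace2 r d (\<sigma> x)) $$ (i, j)"
    using ij by (simp add: mixture_def ptrace2_def sum_distrib_left)
qed (auto simp: ptrace2_def mixture_def)

text \<open>No signalling: the channel sits on the second factor and preserves the trace of each
  block, so the reduced state on the first factor is unaffected.\<close>

lemma ptrace2_id_tensor:
  assumes ch: "channel din dout \<Phi>"
  shows "ptrace2 k dout (id_tensor k din dout \<Phi> X) = ptrace2 k din X"
proof (rule eq_matI)
  fix i j assume "i < dim_row (ptrace2 k din X)" "j < dim_col (ptrace2 k din X)"
  then have ij: "i < k" "j < k" by (auto simp: ptrace2_def)
  have "ptrace2 k dout (id_tensor k din dout \<Phi> X) $$ (i, j) = mtrace dout (\<Phi> (blk din X i j))"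
    using ij by (simp add: ptrace2_def mtrace_def id_tensor_entry)
  also have "\<dots> = mtrace din (blk din X i j)" by (simp add: channelD(3)[OF ch])
  finally show "ptrace2 k dout (id_tensor k din dout \<Phi> X) $$ (i, j) = ptrace2 k din X $$ (i, j)"
    using ij by (simp add: ptrace2_def mtrace_def blk_def)
qed (auto simp: ptrace2_def)

lemma channel_density:
  "channel din dout \<Phi> \<Longrightarrow> density din \<rho> \<Longrightarrow> density dout (\<Phi> \<rho>)"
  using channel_psd channelD(3) densityD unfolding density_def by metis

text \<open>The call does not touch R, so S(XR) and S(R) agree before and after it, and the entropy
  of p occurs in both joint states. What survives is a difference of Holevo quantities for the
  letter, on RB and on RA.\<close>

lemma cmi_diff:
  assumes ch: "\<And>x. x < k \<Longrightarrow> channel dA dB (N x)" and p: "\<And>x. x < k \<Longrightarrow> 0 \<le> p x"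
    and \<sigma>: "\<And>x. x < k \<Longrightarrow> density (r * dA) (\<sigma> x)"
  defines "\<omega> \<equiv> \<lambda>x. id_tensor r dA dB (N x) (\<sigma> x)"
  shows "cmi k r dB (cq_state k (r * dB) p \<omega>) - cmi k r dA (cq_state k (r * dA) p \<sigma>) =
     (vN_entropy (r * dB) (mixture k (r * dB) p \<omega>) - (\<Sum>x<k. p x * vN_entropy (r * dB) (\<omega> x)))
   - (vN_entropy (r * dA) (mixture k (r * dA) p \<sigma>) - (\<Sum>x<k. p x * vN_entropy (r * dA) (\<sigma> x)))"
proof -
  have pt: "ptrace2 r dB (\<omega> x) = ptrace2 r dA (\<sigma> x)" if "x < k" for x
    unfolding \<omega>_def by (rule ptrace2_id_tensor[OF ch[OF that]])
  have "cq_state k r p (\<lambda>x. ptrace2 r dB (\<omega> x)) = cq_state k r p (\<lambda>x. ptrace2 r dA (\<sigma> x))"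
    by (rule eq_matI) (auto simp: cq_state_def pt product_index_div_mod)
  moreover have "mixture k r p (\<lambda>x. ptrace2 r dB (\<omega> x)) = mixture k r p (\<lambda>x. ptrace2 r dA (\<sigma> x))"
    by (rule eq_matI) (auto simp: mixture_def pt)
  moreover have "density (r * dB) (\<omega> x)" if "x < k" for x
    unfolding \<omega>_def using channel_density[OF channel_id_tensor[OF ch[OF that]] \<sigma>[OF that]] .
  ultimately show ?thesis
    unfolding cmi_def ptrace2_cq_state ptrace1_cq_state ptrace2_mixture
    using vN_entropy_cq_state[of k p "r * dB" \<omega>] vN_entropy_cq_state[of k p "r * dA" \<sigma>] p \<sigma> by simp
qed

section \<open>Splitting the information by letter\<close>

lemma sum_fibres:
  fixes e :: "nat \<Rightarrow> nat" and g :: "nat \<Rightarrow> 'b::comm_monoid_add"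
  assumes "\<And>m. m < M \<Longrightarrow> e m < k"
  shows "(\<Sum>x<k. \<Sum>m\<in>{m \<in> {..<M}. e m = x}. g m) = (\<Sum>m<M. g m)"
  by (rule sum.group) (use assms in auto)

text \<open>Chain rule for a letter that is a function of the message: information about the letter
  plus conditional information given the letter. A letter used by no message has weight 0, so
  \<open>s x\<close> is free there.\<close>

lemma holevo_grouping:
  fixes e :: "nat \<Rightarrow> nat" and M :: nat
  assumes M: "0 < M" and e: "\<And>m. m < M \<Longrightarrow> e m < k"
    and I: "\<And>x. I x = {m \<in> {..<M}. e m = x}"
    and p: "\<And>x. p x = card (I x) / M"
    and s: "\<And>x. x < k \<Longrightarrow> I x \<noteq> {} \<Longrightarrow> s x = mavg d (I x) f"
  shows "holevo d {..<M} f = vN_entropy d (mixture k d p s) - (\<Sum>x<k. p x * vN_entropy d (s x))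
      + (\<Sum>x<k. p x * holevo d (I x) f)"
proof -
  have grpC: "(\<Sum>x<k. \<Sum>m\<in>I x. g m) = (\<Sum>m<M. g m)" for g :: "nat \<Rightarrow> complex"
    unfolding I by (rule sum_fibres[OF e])
  have grpR: "(\<Sum>x<k. \<Sum>m\<in>I x. g m) = (\<Sum>m<M. g m)" for g :: "nat \<Rightarrow> real"
    unfolding I by (rule sum_fibres[OF e])
  have fin: "finite (I x)" for x by (simp add: I)
  have avg: "mixture k d p s = mavg d {..<M} f"
  proof (rule eq_matI)
    fix i j assume "i < dim_row (mavg d {..<M} f)" "j < dim_col (mavg d {..<M} f)"
    then have ij: "i < d" "j < d" by (auto simp: mavg_def)
    have "of_real (p x) * s x $$ (i, j) = (\<Sum>m\<in>I x. f m $$ (i, j) / of_nat M)" if x: "x < k" for x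
    proof (cases "I x = {}")
      case False
      then have "card (I x) \<noteq> 0" using fin by simp
      then show ?thesis using s[OF x False] ij by (simp add: p mavg_def sum_divide_distrib[symmetric])
    qed (simp add: p)
    then show "mixture k d p s $$ (i, j) = mavg d {..<M} f $$ (i, j)"
      using ij grpC[of "\<lambda>m. f m $$ (i, j) / of_nat M"] by (simp add: mixture_def mavg_def sum_divide_distrib)
  qed (auto simp: mixture_def mavg_def)
  have "p x * vN_entropy d (s x) - p x * holevo d (I x) f = (\<Sum>m\<in>I x. vN_entropy d (f m) / M)" if x: "x < k" for x
  proof (cases "I x = {}")
    case False
    then have "card (I x) \<noteq> 0" using fin by simp
    then show ?thesis using s[OF x False]
      by (simp add: p holevo_def sum_divide_distrib[symmetric] algebra_simps diff_divide_distrib)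
  qed (simp add: p)
  then have "(\<Sum>x<k. p x * vN_entropy d (s x)) - (\<Sum>x<k. p x * holevo d (I x) f) = (\<Sum>m<M. vN_entropy d (f m) / M)"
    using grpR[of "\<lambda>m. vN_entropy d (f m) / M"] by (simp add: sum_subtractf[symmetric])
  then show ?thesis unfolding avg holevo_def by (simp add: sum_divide_distrib)
qed

text \<open>Grouping the messages by the letter they use turns the information about the message
  into information about the letter plus conditional information, and only the first part can
  grow, since for a given letter the cell is a fixed channel.\<close>
theorem holevo_increase_le_bound:
  fixes e :: "nat \<Rightarrow> nat"
  assumes N: "memory_cell nX dA dB N" and M: "0 < M" and r: "0 < r" and e: "\<And>m. m < M \<Longrightarrow> e m < nX"
    and \<tau>: "\<And>m. m < M \<Longrightarrow> density (r * dA) (\<tau> m)"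
  shows "ereal (holevo (r * dB) {..<M} (\<lambda>m. id_tensor r dA dB (N (e m)) (\<tau> m)) - holevo (r * dA) {..<M} \<tau>)
     \<le> reading_bound nX dA dB N"
proof -
  have ch: "channel dA dB (N x)" if "x < nX" for x using N that by (auto simp: memory_cell_def)
  define \<Psi> where "\<Psi> x = id_tensor r dA dB (N x)" for x
  have ch\<Psi>: "channel (r * dA) (r * dB) (\<Psi> x)" if "x < nX" for x
    unfolding \<Psi>_def by (rule channel_id_tensor[OF ch[OF that]])
  define I where "I = (\<lambda>x. {m \<in> {..<M}. e m = x})"
  define p where "p x = card (I x) / M" for x
  \<comment> \<open>The supremum asks for a state at every letter, including those that no message
    uses; there \<open>\<tau> 0\<close> is a placeholder of weight 0.\<close>
  define \<sigma> where "\<sigma> x = (if I x = {} then \<tau> 0 else mavg (r * dA) (I x) \<tau>)" for x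
  have I_eq: "I x = {m \<in> {..<M}. e m = x}" for x by (simp add: I_def)
  have IM: "m < M" "e m = x" if "m \<in> I x" for x m
    using that by (auto simp: I_def)
  have fin: "finite (I x)" for x by (simp add: I_def)
  have \<sigma>_mem: "\<sigma> x = mavg (r * dA) (I x) \<tau>" if "x < nX" "I x \<noteq> {}" for x
    using that by (simp add: \<sigma>_def)
  have \<sigma>d: "density (r * dA) (\<sigma> x)" for x
  proof (cases "I x = {}")
    case False
    have "psd (r * dA) (mavg (r * dA) (I x) \<tau>)"
      by (rule psd_mavg) (use IM densityD[OF \<tau>] in auto)
    moreover have "mtrace (r * dA) (mavg (r * dA) (I x) \<tau>) = 1"
      using False fin IM densityD(3)[OF \<tau>] by (simp add: mtrace_mavg)
    ultimately show ?thesis using False by (simp add: \<sigma>_def density_def)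
  qed (use \<tau> M in \<open>simp add: \<sigma>_def\<close>)
  have p0: "0 \<le> p x" for x by (simp add: p_def)
  have p1: "(\<Sum>x<nX. p x) = 1"
  proof -
    have "(\<Sum>x<nX. \<Sum>m\<in>I x. 1 :: real) = (\<Sum>m<M. 1)"
      unfolding I_def by (rule sum_fibres[OF e])
    then show ?thesis using M by (simp add: p_def sum_divide_distrib[symmetric])
  qed
  define \<omega> where "\<omega> = (\<lambda>m. \<Psi> (e m) (\<tau> m))"
  \<comment> \<open>Within a class all messages undergo the same channel, so the average of the
    outputs is the output of the average.\<close>
  have mem: "\<Psi> x (\<sigma> x) = mavg (r * dB) (I x) \<omega>" if "x < nX" "I x \<noteq> {}" for x
  proof -
    have "\<Psi> x (\<sigma> x) = mavg (r * dB) (I x) (\<lambda>m. \<Psi> x (\<tau> m))"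
      using that densityD(2)[OF \<tau>] IM by (auto simp: \<sigma>_def intro!: channel_mavg[OF ch\<Psi>])
    also have "\<dots> = mavg (r * dB) (I x) \<omega>" by (rule mavg_cong) (simp add: \<omega>_def IM)
    finally show ?thesis .
  qed
  have cond: "p x * holevo (r * dB) (I x) \<omega> \<le> p x * holevo (r * dA) (I x) \<tau>" if x: "x < nX" for x
  proof (cases "I x = {}")
    case False
    have "holevo (r * dB) (I x) \<omega> = holevo (r * dB) (I x) (\<lambda>m. \<Psi> x (\<tau> m))"
    proof -
      have "mavg (r * dB) (I x) \<omega> = mavg (r * dB) (I x) (\<lambda>m. \<Psi> x (\<tau> m))"
        by (rule mavg_cong) (simp add: \<omega>_def IM)
      then show ?thesis unfolding holevo_def by (simp add: \<omega>_def IM)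
    qed
    also have "\<dots> \<le> holevo (r * dA) (I x) \<tau>"
      using False fin IM densityD(1)[OF \<tau>] by (intro holevo_channel_le[OF ch\<Psi>[OF x]]) auto
    finally show ?thesis using p0 by (rule mult_left_mono)
  qed (simp add: p_def)
  have "holevo (r * dB) {..<M} \<omega> - holevo (r * dA) {..<M} \<tau> \<le>
     (vN_entropy (r * dB) (mixture nX (r * dB) p (\<lambda>x. \<Psi> x (\<sigma> x))) - (\<Sum>x<nX. p x * vN_entropy (r * dB) (\<Psi> x (\<sigma> x))))
   - (vN_entropy (r * dA) (mixture nX (r * dA) p \<sigma>) - (\<Sum>x<nX. p x * vN_entropy (r * dA) (\<sigma> x)))"
    using holevo_grouping[OF M e I_eq p_def mem] holevo_grouping[OF M e I_eq p_def \<sigma>_mem]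
      sum_mono[of "{..<nX}", OF cond] by simp
  also have "\<dots> = cmi nX r dB (cq_state nX (r * dB) p (\<lambda>x. id_tensor r dA dB (N x) (\<sigma> x))) - cmi nX r dA (cq_state nX (r * dA) p \<sigma>)"
    unfolding \<Psi>_def by (rule cmi_diff[symmetric]) (use ch p0 \<sigma>d in auto)
  finally have "ereal (holevo (r * dB) {..<M} \<omega> - holevo (r * dA) {..<M} \<tau>) \<le>
    ereal (cmi nX r dB (cq_state nX (r * dB) p (\<lambda>x. id_tensor r dA dB (N x) (\<sigma> x))) - cmi nX r dA (cq_state nX (r * dA) p \<sigma>))"
    by simp
  also have "\<dots> \<le> reading_bound nX dA dB N"
    unfolding reading_bound_def by (rule Sup_upper) (use r p0 p1 \<sigma>d in blast)
  finally show ?thesis unfolding \<omega>_def \<Psi>_def .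
qed

text \<open>A real majorant b stands in for the supremum, which lives in the extended reals. The n
  calls contribute at most n b, and the term with 1 / ln 2 is the loss of the Fano step, divided by
  n.\<close>

lemma reading_protocol_weak_converse:
  assumes N: "memory_cell nX dA dB N" and n: "0 < n" and prot: "reading_protocol nX dA dB N n R \<epsilon>"
    and \<epsilon>: "\<epsilon> < 1" and b: "reading_bound nX dA dB N \<le> ereal b"
  shows "(1 - \<epsilon>) * R - (1 / ln 2) / n \<le> b"
proof -
  from prot obtain M enc dR \<rho> Ach \<Lambda> where P: "0 < M \<and> log 2 (real M) / real n \<ge> R \<and>
        (\<forall>m<M. \<forall>i<n. enc m i < nX) \<and>
        (\<forall>i<n. 0 < dR i) \<and>
        density (dR 0 * dA) \<rho> \<and>
        (\<forall>i. Suc i < n \<longrightarrow> channel (dR i * dB) (dR (Suc i) * dA) (Ach i)) \<and>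
        (\<forall>m<M. psd (dR (n - 1) * dB) (\<Lambda> m)) \<and>
        (\<forall>i<dR (n - 1) * dB. \<forall>j<dR (n - 1) * dB.
            (\<Sum>m<M. \<Lambda> m $$ (i, j)) = (if i = j then 1 else 0)) \<and>
        (1 / real M) * (\<Sum>m<M. Re (mtrace (dR (n - 1) * dB) (\<Lambda> m * reading_out N dA dB dR \<rho> Ach enc m (n - 1))))
          \<ge> 1 - \<epsilon>"
    unfolding reading_protocol_def by - (elim exE, rule that)
  then have M: "0 < M" and rate: "R \<le> log 2 (real M) / real n"
    and enc: "\<And>m i. m < M \<Longrightarrow> i < n \<Longrightarrow> enc m i < nX" and dR: "\<And>i. i < n \<Longrightarrow> 0 < dR i"
    and \<rho>: "density (dR 0 * dA) \<rho>"
    and Ach: "\<And>i. Suc i < n \<Longrightarrow> channel (dR i * dB) (dR (Suc i) * dA) (Ach i)"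
    and \<Lambda>: "\<And>m. m < M \<Longrightarrow> psd (dR (n - 1) * dB) (\<Lambda> m)"
    and \<Lambda>1: "\<And>i j. i < dR (n - 1) * dB \<Longrightarrow> j < dR (n - 1) * dB \<Longrightarrow> (\<Sum>m<M. \<Lambda> m $$ (i, j)) = (if i = j then 1 else 0)"
    and succ: "1 - \<epsilon> \<le> (1 / real M) * (\<Sum>m<M. Re (mtrace (dR (n - 1) * dB) (\<Lambda> m * reading_out N dA dB dR \<rho> Ach enc m (n - 1))))"
    by simp_all
  define out where "out i m = reading_out N dA dB dR \<rho> Ach enc m i" for i m
  have ch: "channel (dR i * dA) (dR i * dB) (id_tensor (dR i) dA dB (N (enc m i)))" if "i < n" "m < M" for i m
    using channel_id_tensor N enc[OF that(2,1)] by (auto simp: memory_cell_def)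
  have inc: "holevo (dR i * dB) {..<M} (\<lambda>m. id_tensor (dR i) dA dB (N (enc m i)) (\<tau> m)) \<le> holevo (dR i * dA) {..<M} \<tau> + b"
    if "i < n" "\<And>m. m < M \<Longrightarrow> density (dR i * dA) (\<tau> m)" for i \<tau>
  proof -
    have "ereal (holevo (dR i * dB) {..<M} (\<lambda>m. id_tensor (dR i) dA dB (N (enc m i)) (\<tau> m)) - holevo (dR i * dA) {..<M} \<tau>) \<le> ereal b"
      using holevo_increase_le_bound[OF N M dR[OF that(1)], of "\<lambda>m. enc m i" \<tau>] enc[OF _ that(1)] that(2) b
      by (meson order_trans)
    then show ?thesis by simp
  qed
  \<comment> \<open>Rounds count from 0, so the state after round i has passed through i + 1
    calls.\<close>
  have "(\<forall>m<M. density (dR i * dB) (out i m)) \<and> holevo (dR i * dB) {..<M} (out i) \<le> (real i + 1) * b" if "i < n" for i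
    using that
  proof (induction i)
    case 0
    \<comment> \<open>The initial state is the same for every message, so it equals its mean and
      carries no information.\<close>
    have "mavg (dR 0 * dA) {..<M} (\<lambda>m. \<rho>) = \<rho>"
      using M densityD(2)[OF \<rho>] by (intro eq_matI) (auto simp: mavg_def)
    then have "holevo (dR 0 * dA) {..<M} (\<lambda>m. \<rho>) = 0" using M by (simp add: holevo_def)
    then show ?case
      using inc[OF n, of "\<lambda>m. \<rho>"] channel_density[OF ch[OF n] \<rho>] \<rho> by (simp add: out_def[abs_def])
  next
    case (Suc i)
    then have IH: "\<And>m. m < M \<Longrightarrow> density (dR i * dB) (out i m)" "holevo (dR i * dB) {..<M} (out i) \<le> (real i + 1) * b"
      by auto
    let ?\<tau> = "\<lambda>m. Ach i (out i m)"
    have \<tau>: "density (dR (Suc i) * dA) (?\<tau> m)" if "m < M" for m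
      using channel_density[OF Ach[OF Suc.prems] IH(1)[OF that]] .
    have "holevo (dR (Suc i) * dA) {..<M} ?\<tau> \<le> holevo (dR i * dB) {..<M} (out i)"
      using M densityD(1)[OF IH(1)] by (intro holevo_channel_le[OF Ach[OF Suc.prems]]) auto
    then have "holevo (dR (Suc i) * dB) {..<M} (out (Suc i)) \<le> (real i + 1) * b + b"
      using inc[OF Suc.prems, of ?\<tau>] \<tau> IH(2) by (simp add: out_def[abs_def])
    moreover have "density (dR (Suc i) * dB) (out (Suc i) m)" if "m < M" for m
      using channel_density[OF ch[OF Suc.prems that] \<tau>[OF that]] by (simp add: out_def)
    ultimately show ?case by (simp add: algebra_simps)
  qed
  from this[of "n - 1"] n
  have od: "\<And>m. m < M \<Longrightarrow> density (dR (n - 1) * dB) (out (n - 1) m)"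
    and hb: "holevo (dR (n - 1) * dB) {..<M} (out (n - 1)) \<le> n * b" by (auto simp: of_nat_diff)
  have "(1 / M) * (\<Sum>m<M. Re (mtrace (dR (n - 1) * dB) (\<Lambda> m * out (n - 1) m))) * log 2 M - 1 / ln 2 \<le> n * b"
    using holevo_ge_success[OF M od \<Lambda> \<Lambda>1] hb by (rule order_trans)
  \<comment> \<open>Since M \<ge> 1 the logarithm is nonnegative, so the success probability may be
    replaced by its lower bound.\<close>
  moreover have "(1 - \<epsilon>) * log 2 M \<le> (1 / M) * (\<Sum>m<M. Re (mtrace (dR (n - 1) * dB) (\<Lambda> m * out (n - 1) m))) * log 2 M"
    using succ M unfolding out_def by (intro mult_right_mono) auto
  moreover have "(1 - \<epsilon>) * (n * R) \<le> (1 - \<epsilon>) * log 2 M"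
    using rate n \<epsilon> by (intro mult_left_mono) (auto simp: pos_le_divide_eq mult.commute)
  ultimately have "(1 - \<epsilon>) * (n * R) - 1 / ln 2 \<le> n * b" by linarith
  then have "((1 - \<epsilon>) * (n * R) - 1 / ln 2) / n \<le> n * b / n" by (rule divide_right_mono) simp
  then show ?thesis using n by (simp add: diff_divide_distrib)
qed

text \<open>Letting n grow at fixed error removes the Fano term and leaves (1 - \<epsilon>) (R -
  \<delta>) \<le> b; afterwards error and rate slack go to 0.\<close>

theorem mainTheorem9:
  fixes nX dA dB :: nat and N :: "nat \<Rightarrow> complex mat \<Rightarrow> complex mat"
  assumes "memory_cell nX dA dB N"
  shows "reading_capacity nX dA dB N \<le> reading_bound nX dA dB N"
  unfolding reading_capacity_def
proof (rule Sup_least, clarify)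
  fix R assume R: "achievable_rate nX dA dB N R"
  show "ereal R \<le> reading_bound nX dA dB N"
  \<comment> \<open>Comparing with all real majorants b suffices; a supremum equal to \<infinity>
    has none.\<close>
  proof (rule ereal_le_real)
    fix b assume b: "reading_bound nX dA dB N \<le> ereal b"
    have step: "(1 - \<epsilon>) * (R - \<delta>) \<le> b" if \<epsilon>: "0 < \<epsilon>" "\<epsilon> < 1" and \<delta>: "0 < \<delta>" for \<epsilon> \<delta>
    proof -
      have "\<forall>\<^sub>F n in sequentially. (1 - \<epsilon>) * (R - \<delta>) - (1 / ln 2) / real n \<le> b"
      proof -
        have "\<forall>\<^sub>F n in sequentially. 0 < n \<and> reading_protocol nX dA dB N n (R - \<delta>) \<epsilon>"
          using R \<epsilon> \<delta> unfolding achievable_rate_def by blast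
        then show ?thesis
          by eventually_elim (rule reading_protocol_weak_converse[OF assms _ _ \<epsilon>(2) b], auto)
      qed
      moreover have "(\<lambda>n. (1 - \<epsilon>) * (R - \<delta>) - (1 / ln 2) / real n) \<longlonglongrightarrow> (1 - \<epsilon>) * (R - \<delta>) - 0"
        by (intro tendsto_diff tendsto_const lim_const_over_n)
      ultimately show ?thesis by (intro tendsto_upperbound[of _ "(1 - \<epsilon>) * (R - \<delta>)" sequentially]) auto
    qed
    \<comment> \<open>One variable serves as both error and rate slack; eventually it lies in (0,
      1), where \<open>step\<close> applies.\<close>
    have "((\<lambda>\<delta>. (1 - \<delta>) * (R - \<delta>)) \<longlongrightarrow> (1 - 0) * (R - 0)) (at_right 0)"
      by (intro tendsto_intros)
    moreover have "\<forall>\<^sub>F \<delta> in at_right 0. (1 - \<delta>) * (R - \<delta>) \<le> b"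
      using eventually_at_right_real[of 0 "1::real"] by (auto elim!: eventually_mono intro: step)
    ultimately have "(1 - 0) * (R - 0) \<le> b" by (intro tendsto_upperbound) auto
    then show "ereal R \<le> ereal b" by simp
  qed
qed

end
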